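(* (i) The matrices $\big[\binom{n}{k}k^{n-k}\big]_{n,k\ge 0}$ and $\big[\binom{n-1}{k-1}n^{n-k}\big]_{n,k\ge 1}$ are TP. (ii) The matrices $\big[\binom{n}{k}k^{n-k}k!\big]_{n,k\ge 0}$ and $\big[\binom{n-1}{k-1}n^{n-k}k!\big]_{n,k\ge 1}$ are TP. (iii) The sequence $(\mathcal{I}_n(q))_{n\ge 0}$ is $q$-SM and $3$-$q$-log-convex, where $\mathcal{I}_0(q)=1$ and $\mathcal{I}_n(q)=\sum_{k=1}^n\binom{n-1}{k-1}n^{n-k}q^k$ for $n\ge 1$. (iv) The sequence $((1+qn)^{n-1})_{n\ge 1}$ is $q$-SM and $3$-$q$-log-convex. (v) The sequence $(n^{n-1})_{n\ge 1}$ is SM. (vi) Both of the following convolutions preserve the Stieltjes moment property of sequences: $z_n=\sum_{k\ge 1}\binom{n-1}{k-1}n^{n-k}x_ky_{n-k}$ for $n\ge 1$, with $z_0=x_0y_0$; and $z_n=\sum_{k\ge 0}\binom{n}{k}(n+1)^{n-k}x_ky_{n-k}$ for $n\ge 0$.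
   Context: Conventions: $0^0=1$, and $\binom{n}{k}=0$ for $k>n$ (entries with $k>n$ are $0$). A real matrix is TP if all its minors are nonnegative. A real sequence $(a_k)_{k\ge 0}$ is SM (Stieltjes moment) if $a_k=\int_0^{+\infty}x^k\,d\mu(x)$ for a nonnegative measure $\mu$ on $[0,+\infty)$. A sequence $(\alpha_n(q))_{n\ge 0}$ in $\mathbb{R}[q]$ is $q$-SM if all minors of $[\alpha_{i+j}(q)]_{i,j\ge 0}$ are polynomials with nonnegative coefficients. Let $\mathcal{L}[\alpha_i]=\alpha_{i-1}\alpha_{i+1}-\alpha_i^2$ for $i\ge 1$ and $\mathcal{L}^m=\mathcal{L}(\mathcal{L}^{m-1})$ (so $\mathcal{L}^m[\alpha_i]$ is defined for $i\ge m$); the sequence is $3$-$q$-log-convex if for $m=1,2,3$ all $\mathcal{L}^m[\alpha_i]$ have nonnegative coefficients. A sequence indexed by $n\ge 1$ has one of these properties if its re-indexing $(\alpha_{n+1})_{n\ge 0}$ does. A convolution preserves the Stieltjes moment property if $(z_n)_{n\ge 0}$ is SM whenever the real sequences $(x_n)_{n\ge 0}$ and $(y_n)_{n\ge 0}$ both are. *)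

theory Defs
  imports
    "HOL-Analysis.Bochner_Integration"
    "HOL-Computational_Algebra.Polynomial"
    "Jordan_Normal_Form.Determinant"
begin

text \<open>
  Infinite matrices and sequences are functions on \<open>nat\<close>, indexed from 0.  A family indexed by
  \<open>n \<ge> 1\<close> (or \<open>n, k \<ge> 1\<close>) is shifted to this form with \<open>Suc\<close>.
\<close>

definition matrix_minor ::
  "(nat \<Rightarrow> nat \<Rightarrow> 'a::comm_ring_1) \<Rightarrow> nat \<Rightarrow> (nat \<Rightarrow> nat) \<Rightarrow> (nat \<Rightarrow> nat) \<Rightarrow> 'a" where
  "matrix_minor A r f g = Determinant.det (Matrix.mat r r (\<lambda>(i, j). A (f i) (g j)))"

text \<open>All finite square minors: rows and columns are selected in increasing order.\<close>

definition all_minors :: "('a::comm_ring_1 \<Rightarrow> bool) \<Rightarrow> (nat \<Rightarrow> nat \<Rightarrow> 'a) \<Rightarrow> bool" where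
  "all_minors P A \<longleftrightarrow>
     (\<forall>r f g. strict_mono_on {..<r} f \<longrightarrow> strict_mono_on {..<r} g \<longrightarrow>
        P (matrix_minor A r f g))"

definition totally_positive :: "(nat \<Rightarrow> nat \<Rightarrow> real) \<Rightarrow> bool" where
  "totally_positive A \<longleftrightarrow> all_minors (\<lambda>d. 0 \<le> d) A"

text \<open>
  \<open>has_bochner_integral\<close> includes integrability: all moments are finite (for \<open>k = 0\<close>: \<open>\<mu>\<close> is a
  finite measure), as is implicit in the \<open>a k\<close> being real numbers.
\<close>

definition stieltjes_moment :: "(nat \<Rightarrow> real) \<Rightarrow> bool" where
  "stieltjes_moment a \<longleftrightarrow>
     (\<exists>\<mu> :: real measure. sets \<mu> = sets (restrict_space borel {0..}) \<and>
        (\<forall>k. has_bochner_integral \<mu> (\<lambda>x. x ^ k) (a k)))"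

definition nonneg_coeffs :: "real poly \<Rightarrow> bool" where
  "nonneg_coeffs p \<longleftrightarrow> (\<forall>i. 0 \<le> Polynomial.coeff p i)"

definition q_stieltjes_moment :: "(nat \<Rightarrow> real poly) \<Rightarrow> bool" where
  "q_stieltjes_moment \<alpha> \<longleftrightarrow> all_minors nonneg_coeffs (\<lambda>i j. \<alpha> (i + j))"

text \<open>
  The value of \<open>log_convex_op \<alpha>\<close> at 0 is meaningless (\<open>0 - 1 = 0\<close> in \<open>nat\<close>).  The \<open>m\<close>-th iterate
  at \<open>i\<close> depends only on meaningful values when \<open>i \<ge> m\<close>, which is the range used below.
\<close>

definition log_convex_op :: "(nat \<Rightarrow> real poly) \<Rightarrow> nat \<Rightarrow> real poly" where
  "log_convex_op \<alpha> i = \<alpha> (i - 1) * \<alpha> (i + 1) - (\<alpha> i)\<^sup>2"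

definition q_log_convex :: "nat \<Rightarrow> (nat \<Rightarrow> real poly) \<Rightarrow> bool" where
  "q_log_convex r \<alpha> \<longleftrightarrow>
     (\<forall>m\<in>{1..r}. \<forall>i\<ge>m. nonneg_coeffs ((log_convex_op ^^ m) \<alpha> i))"

definition poly_I :: "nat \<Rightarrow> real poly" where
  "poly_I n =
     (if n = 0 then 1
      else (\<Sum>k = 1..n. Polynomial.monom (real ((n - 1) choose (k - 1)) * real n ^ (n - k)) k))"

definition preserves_stieltjes_moment ::
  "((nat \<Rightarrow> real) \<Rightarrow> (nat \<Rightarrow> real) \<Rightarrow> nat \<Rightarrow> real) \<Rightarrow> bool" where
  "preserves_stieltjes_moment conv \<longleftrightarrow>
     (\<forall>x y. stieltjes_moment x \<longrightarrow> stieltjes_moment y \<longrightarrow> stieltjes_moment (conv x y))"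

text \<open>In both convolutions the terms with \<open>k > n\<close> vanish because of the binomial coefficient.\<close>

definition conv_I :: "(nat \<Rightarrow> real) \<Rightarrow> (nat \<Rightarrow> real) \<Rightarrow> nat \<Rightarrow> real" where
  "conv_I x y n =
     (if n = 0 then x 0 * y 0
      else (\<Sum>k = 1..n. real ((n - 1) choose (k - 1)) * real n ^ (n - k) * x k * y (n - k)))"

definition conv_A :: "(nat \<Rightarrow> real) \<Rightarrow> (nat \<Rightarrow> real) \<Rightarrow> nat \<Rightarrow> real" where
  "conv_A x y n = (\<Sum>k = 0..n. real (n choose k) * real (n + 1) ^ (n - k) * x k * y (n - k))"

end

theory Submission
  imports Defs "HOL-Probability.Helly_Selection" "HOL-Analysis.Gamma_Function"
begin

text \<open>
  The statement is about the tree function \<open>T(z) = z exp (T(z))\<close>.  The matrix with entries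
  \<open>binomial(n, k) k^(n-k)\<close> is the exponential Riordan array of \<open>z exp z\<close>, and
  \<open>binomial(n-1, k-1) n^(n-k)\<close> is that of \<open>T\<close>.

  \<^bold>\<open>Minors.\<close>  The nonnegative reals and the polynomials with nonnegative coefficients are cones
  closed under addition and multiplication, so all positivity of minors is treated over such a
  cone (locale \<open>positive_cone\<close>).  By the Cauchy-Binet formula, products preserve nonnegativity of
  minors, and so does generating the rows (or the columns) of a matrix one from the other by a
  fixed matrix \<open>Q\<close> with nonnegative minors, starting from the first unit vector
  (\<open>tp_iterate_rows\<close>, \<open>tp_iterate_columns\<close>).  If the rows of a lower triangular matrix \<open>A\<close> arise
  in this way from \<open>Q\<close>, then \<open>A (i + j) 0\<close> is the entry at \<open>(0, 0)\<close> of \<open>Q^i Q^j\<close>, hence the Hankel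
  matrix of the first column of \<open>A\<close> is the product of \<open>A\<close> and of the matrix whose columns are
  generated by \<open>Q\<close>; it has nonnegative minors as well (\<open>tp_output_matrix_Hankel\<close>).  This is
  applied to the array \<open>Abel_matrix x y\<close>, whose first column is \<open>x (x + n y)^(n-1)\<close>: for it \<open>Q\<close> is
  the product of a weighted Pascal matrix, a matrix of falling factorials and a bidiagonal matrix.
  The choice \<open>x = q, y = 1\<close> gives the polynomials \<open>I_n(q)\<close>, \<open>x = 1, y = q\<close> gives
  \<open>(1 + q n)^(n-1)\<close>, and \<open>x = 0, y = 1\<close> gives the second matrix.  Log-convexity of order 3 follows
  since by the Desnanot-Jacobi identity the iterates of the operator are positive expressions in
  contiguous Hankel minors.

  \<^bold>\<open>Moments.\<close>  Stieltjes moment sequences are closed under sums, products and (by Helly's theorem)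
  pointwise limits.  Approximating the measures of \<open>x\<close> and \<open>y\<close> by finitely many atoms reduces a
  convolution to \<open>x_k = s^k\<close>, \<open>y_k = t^k\<close>, where it equals \<open>s (s + n t)^(n-1)\<close> or
  \<open>(s + (n + 1) t)^n\<close> (\<open>preserves_stieltjes_moment_if_geometric\<close>).  These are limits
  of quotients of rising factorials: for \<open>r = s m\<close>,
  the sequence \<open>s/(s+n) * pochhammer r ((m+1) n) / pochhammer r (m n) / m^n\<close> tends
  to \<open>s (s + n)^(n-1)\<close>, and by the Gauss multiplication formula it is a product of moment sequences
  \<open>pochhammer a n / pochhammer c n\<close> with \<open>a < c\<close> (Beta distribution), of one \<open>pochhammer a n\<close>
  (Gamma distribution) and of a geometric sequence.
\<close>

section \<open>Minors and the Cauchy-Binet formula\<close>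

lemma matrix_minor_leibniz:
  "matrix_minor A r f g =
     (\<Sum>p | p permutes {0..<r}. of_int (sign p) * (\<Prod>i = 0..<r. A (f i) (g (p i))))"
proof -
  have "(\<Prod>i = 0..<r. Matrix.mat r r (\<lambda>(i, j). A (f i) (g j)) $$ (i, p i)) =
      (\<Prod>i = 0..<r. A (f i) (g (p i)))" if "p permutes {0..<r}" for p
  proof (rule prod.cong)
    fix i assume "i \<in> {0..<r}"
    then show "Matrix.mat r r (\<lambda>(i, j). A (f i) (g j)) $$ (i, p i) = A (f i) (g (p i))"
      using permutes_in_image[OF that, of i] by simp
  qed simp
  then show ?thesis
    unfolding matrix_minor_def Determinant.det_def by simp
qed

lemma matrix_minor_cong:
  assumes "\<And>i j. i < r \<Longrightarrow> j < r \<Longrightarrow> A (f i) (g j) = B (f' i) (g' j)"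
  shows "matrix_minor A r f g = matrix_minor B r f' g'"
  unfolding matrix_minor_def
  by (rule arg_cong[where f = Determinant.det], rule eq_matI) (use assms in auto)

lemma matrix_minor_transpose: "matrix_minor (\<lambda>i j. A j i) r f g = matrix_minor A r g f"
proof -
  have "Matrix.mat r r (\<lambda>(i, j). A (g j) (f i)) = transpose_mat (Matrix.mat r r (\<lambda>(i, j). A (g i) (f j)))"
    by (rule eq_matI) auto
  then show ?thesis
    unfolding matrix_minor_def by (simp add: Determinant.det_transpose[where n = r])
qed

lemma matrix_minor_repeated_row:
  assumes "i < r" "j < r" "i \<noteq> j" "f i = f j"
  shows "matrix_minor A r f g = 0"
  unfolding matrix_minor_def
  by (rule Determinant.det_identical_rows[of _ r i j]) (use assms in \<open>auto intro!: eq_vecI\<close>)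

lemma matrix_minor_permute_rows:
  assumes "p permutes {0..<r}"
  shows "matrix_minor A r (\<lambda>i. f (p i)) g = of_int (sign p) * matrix_minor A r f g"
proof -
  let ?M = "Matrix.mat r r (\<lambda>(i, j). A (f i) (g j))"
  have "Matrix.mat r r (\<lambda>(i, j). A (f (p i)) (g j)) = Matrix.mat r r (\<lambda>(i, j). ?M $$ (p i, j))"
    by (rule eq_matI) (use permutes_in_image[OF assms] in auto)
  then show ?thesis
    unfolding matrix_minor_def using Determinant.det_permute_rows[of ?M r p] assms by simp
qed

lemma matrix_minor_expand:
  "matrix_minor A (Suc r) f g =
     (\<Sum>j<Suc r. (- 1) ^ j * A (f 0) (g j) *
        matrix_minor A r (\<lambda>i. f (Suc i)) (\<lambda>k. g (if k < j then k else Suc k)))"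
proof -
  let ?M = "Matrix.mat (Suc r) (Suc r) (\<lambda>(i, j). A (f i) (g j))"
  have "Determinant.det ?M = (\<Sum>j<Suc r. ?M $$ (0, j) * cofactor ?M 0 j)"
    by (rule laplace_expansion_row) auto
  also have "\<dots> = (\<Sum>j<Suc r. (- 1) ^ j * A (f 0) (g j) *
        matrix_minor A r (\<lambda>i. f (Suc i)) (\<lambda>k. g (if k < j then k else Suc k)))"
  proof (rule sum.cong)
    fix j assume "j \<in> {..<Suc r}"
    then have "mat_delete ?M 0 j =
      Matrix.mat r r (\<lambda>(i, k). A (f (Suc i)) (g (if k < j then k else Suc k)))"
      unfolding mat_delete_def by (intro eq_matI) auto
    then show "?M $$ (0, j) * cofactor ?M 0 j = (- 1) ^ j * A (f 0) (g j) *
        matrix_minor A r (\<lambda>i. f (Suc i)) (\<lambda>k. g (if k < j then k else Suc k))"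
      using \<open>j \<in> {..<Suc r}\<close> unfolding cofactor_def matrix_minor_def by (simp add: ac_simps)
  qed simp
  finally show ?thesis unfolding matrix_minor_def .
qed

lemma matrix_minor_0: "matrix_minor A 0 f g = 1"
  by (simp add: matrix_minor_leibniz sign_id)

text \<open>
  In the shape below the Laplace expansion has a single term.  All inductions on the size of a
  minor rest on this lemma and its transpose, also when the corner entry is \<open>0\<close>.
\<close>

lemma matrix_minor_first_row:
  assumes "\<And>j. j < r \<Longrightarrow> A (f 0) (g (Suc j)) = 0"
  shows "matrix_minor A (Suc r) f g =
    A (f 0) (g 0) * matrix_minor A r (\<lambda>i. f (Suc i)) (\<lambda>i. g (Suc i))"
  unfolding matrix_minor_expand unfolding sum.lessThan_Suc_shift using assms by simp

lemma matrix_minor_first_column: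
  assumes "\<And>i. i < r \<Longrightarrow> A (f (Suc i)) (g 0) = 0"
  shows "matrix_minor A (Suc r) f g =
    A (f 0) (g 0) * matrix_minor A r (\<lambda>i. f (Suc i)) (\<lambda>i. g (Suc i))"
  using matrix_minor_first_row[of r "\<lambda>i j. A j i" g f] assms
  unfolding matrix_minor_transpose[of A] by simp

lemma matrix_minor_mult_functions:
  "matrix_minor (\<lambda>i j. \<Sum>k<N. A i k * B k j) r f g =
     (\<Sum>\<phi>\<in>{0..<r} \<rightarrow>\<^sub>E {..<N}. (\<Prod>i = 0..<r. A (f i) (\<phi> i)) * matrix_minor B r \<phi> g)"
  (is "?L = ?R")
proof -
  have "?L = (\<Sum>p | p permutes {0..<r}. \<Sum>\<phi>\<in>{0..<r} \<rightarrow>\<^sub>E {..<N}.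
      of_int (sign p) * (\<Prod>i = 0..<r. A (f i) (\<phi> i) * B (\<phi> i) (g (p i))))"
    unfolding matrix_minor_leibniz
  proof (rule sum.cong)
    fix p
    have "(\<Prod>i = 0..<r. \<Sum>k<N. A (f i) k * B k (g (p i))) =
        (\<Sum>\<phi>\<in>{0..<r} \<rightarrow>\<^sub>E {..<N}. \<Prod>i = 0..<r. A (f i) (\<phi> i) * B (\<phi> i) (g (p i)))"
      by (rule prod_sum_PiE) simp_all
    then show "of_int (sign p) * (\<Prod>i = 0..<r. \<Sum>k<N. A (f i) k * B k (g (p i))) =
        (\<Sum>\<phi>\<in>{0..<r} \<rightarrow>\<^sub>E {..<N}.
          of_int (sign p) * (\<Prod>i = 0..<r. A (f i) (\<phi> i) * B (\<phi> i) (g (p i))))"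
      by (simp only: sum_distrib_left)
  qed simp
  also have "\<dots> = ?R"
    by (subst sum.swap)
      (simp only: matrix_minor_leibniz prod.distrib sum_distrib_left mult.left_commute)
  finally show ?thesis .
qed

text \<open>
  A map \<open>\<phi>\<close> onto \<open>S\<close> is \<open>e \<circ> p\<close> for a unique permutation \<open>p\<close>.  Sorting the rows of \<open>B\<close> costs the
  sign of \<open>p\<close>, and the signed sum over \<open>p\<close> is the Leibniz formula for the minor of \<open>A\<close>.
\<close>

lemma sum_functions_with_image:
  assumes bij: "bij_betw e {0..<r} S"
  shows "(\<Sum>\<phi> | \<phi> \<in> {0..<r} \<rightarrow>\<^sub>E S \<and> \<phi> ` {0..<r} = S.
            (\<Prod>i = 0..<r. A (f i) (\<phi> i)) * matrix_minor B r \<phi> g)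
         = matrix_minor A r f e * matrix_minor B r e g"
proof -
  let ?F = "\<lambda>\<phi>. (\<Prod>i = 0..<r. A (f i) (\<phi> i)) * matrix_minor B r \<phi> g"
  let ?\<Phi> = "{\<phi>. \<phi> \<in> {0..<r} \<rightarrow>\<^sub>E S \<and> \<phi> ` {0..<r} = S}"
  let ?e' = "inv_into {0..<r} e"
  let ?to = "\<lambda>\<phi> i. if i \<in> {0..<r} then ?e' (\<phi> i) else i"
  let ?from = "\<lambda>p. restrict (\<lambda>i. e (p i)) {0..<r}"
  have fin: "finite S" and card: "card S = r"
    using bij bij_betw_finite[OF bij] bij_betw_same_card[OF bij] by simp_all
  have inj: "inj_on e {0..<r}" and img: "e ` {0..<r} = S"
    using bij by (simp_all add: bij_betw_def)
  have e_inv: "e (?e' s) = s" if "s \<in> S" for s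
    using that img by (simp add: f_inv_into_f)
  have inv_e: "?e' (e i) = i" if "i \<in> {0..<r}" for i
    using inv_into_f_f[OF inj that] .
  have to_permutes: "?to \<phi> permutes {0..<r}" if "\<phi> \<in> ?\<Phi>" for \<phi>
  proof (rule bij_imp_permutes)
    have im: "\<phi> ` {0..<r} = S" using that by simp
    then have "inj_on \<phi> {0..<r}" using card by (intro eq_card_imp_inj_on) simp_all
    then have "bij_betw \<phi> {0..<r} S" using im by (simp add: bij_betw_def)
    then have "bij_betw (?e' \<circ> \<phi>) {0..<r} {0..<r}"
      by (rule bij_betw_trans[OF _ bij_betw_inv_into[OF bij]])
    moreover have "bij_betw (?to \<phi>) {0..<r} {0..<r} = bij_betw (?e' \<circ> \<phi>) {0..<r} {0..<r}"
      by (rule bij_betw_cong) simp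
    ultimately show "bij_betw (?to \<phi>) {0..<r} {0..<r}" by simp
  qed auto
  have to_eq: "e (?to \<phi> i) = \<phi> i" if "\<phi> \<in> ?\<Phi>" "i \<in> {0..<r}" for \<phi> i
  proof -
    have "\<phi> i \<in> S" using that by blast
    then show ?thesis using e_inv that(2) by simp
  qed
  have "sum ?F ?\<Phi> =
      (\<Sum>p | p permutes {0..<r}. (\<Prod>i = 0..<r. A (f i) (e (p i))) * (of_int (sign p) * matrix_minor B r e g))"
  proof (rule sum.reindex_bij_witness[where i = ?from and j = ?to])
    fix \<phi> assume \<phi>: "\<phi> \<in> ?\<Phi>"
    show "?from (?to \<phi>) = \<phi>"
    proof (rule extensionalityI[of _ "{0..<r}"])
      show "\<phi> \<in> extensional {0..<r}" using \<phi> by (simp add: PiE_def)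
      show "?from (?to \<phi>) i = \<phi> i" if "i \<in> {0..<r}" for i
        using that to_eq[OF \<phi> that] by simp
    qed simp
    show "?to \<phi> \<in> {p. p permutes {0..<r}}" using to_permutes[OF \<phi>] by simp
    have "matrix_minor B r (\<lambda>i. e (?to \<phi> i)) g = of_int (sign (?to \<phi>)) * matrix_minor B r e g"
      by (rule matrix_minor_permute_rows[OF to_permutes[OF \<phi>]])
    moreover have "matrix_minor B r (\<lambda>i. e (?to \<phi> i)) g = matrix_minor B r \<phi> g"
      by (rule matrix_minor_cong) (use to_eq[OF \<phi>] in simp)
    moreover have "(\<Prod>i = 0..<r. A (f i) (e (?to \<phi> i))) = (\<Prod>i = 0..<r. A (f i) (\<phi> i))"
      by (rule prod.cong) (use to_eq[OF \<phi>] in simp_all)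
    ultimately show "(\<Prod>i = 0..<r. A (f i) (e (?to \<phi> i))) *
        (of_int (sign (?to \<phi>)) * matrix_minor B r e g) = ?F \<phi>"
      by simp
  next
    fix p assume "p \<in> {p. p permutes {0..<r}}"
    then have p: "p permutes {0..<r}" by simp
    have p_in: "p i \<in> {0..<r}" if "i \<in> {0..<r}" for i
      using permutes_in_image[OF p] that by blast
    show "?to (?from p) = p"
    proof
      fix i show "?to (?from p) i = p i"
        using p_in[of i] inv_e[of "p i"] permutes_not_in[OF p, of i] by auto
    qed
    have "?from p ` {0..<r} = e ` (p ` {0..<r})"
      by (simp add: image_image)
    also have "\<dots> = S" by (simp only: permutes_image[OF p] img)
    finally show "?from p \<in> ?\<Phi>"
      using img p_in by auto
  qed
  also have "\<dots> = matrix_minor A r f e * matrix_minor B r e g"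
    unfolding matrix_minor_leibniz[of A] sum_distrib_right
    by (rule sum.cong) (simp_all add: mult.assoc mult.left_commute)
  finally show ?thesis .
qed

text \<open>
  Multilinearity writes the minor as a sum over all maps from \<open>{..<r}\<close> to \<open>{..<N}\<close>.  Maps that are
  not injective contribute a determinant with a repeated row; the others are grouped by image.
\<close>

theorem Cauchy_Binet:
  "matrix_minor (\<lambda>i j. \<Sum>k<N. A i k * B k j) r f g =
     (\<Sum>S | S \<subseteq> {..<N} \<and> card S = r.
        matrix_minor A r f ((!) (sorted_list_of_set S)) *
        matrix_minor B r ((!) (sorted_list_of_set S)) g)"
proof -
  let ?F = "\<lambda>\<phi>. (\<Prod>i = 0..<r. A (f i) (\<phi> i)) * matrix_minor B r \<phi> g"
  let ?\<S> = "{S. S \<subseteq> {..<N} \<and> card S = r}"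
  let ?\<Phi> = "{\<phi> \<in> {0..<r} \<rightarrow>\<^sub>E {..<N}. inj_on \<phi> {0..<r}}"
  have finS: "finite ?\<S>" by (rule finite_subset[of _ "Pow {..<N}"]) auto
  have fin: "finite ({0..<r} \<rightarrow>\<^sub>E {..<N})" by (intro finite_PiE) auto
  have "matrix_minor (\<lambda>i j. \<Sum>k<N. A i k * B k j) r f g = sum ?F ({0..<r} \<rightarrow>\<^sub>E {..<N})"
    by (rule matrix_minor_mult_functions)
  also have "\<dots> = sum ?F ?\<Phi>"
  proof (rule sum.mono_neutral_right)
    show "\<forall>\<phi>\<in>({0..<r} \<rightarrow>\<^sub>E {..<N}) - ?\<Phi>. ?F \<phi> = 0"
    proof
      fix \<phi> assume "\<phi> \<in> ({0..<r} \<rightarrow>\<^sub>E {..<N}) - ?\<Phi>"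
      then have "\<not> inj_on \<phi> {0..<r}" by blast
      then obtain i j where "i < r" "j < r" "i \<noteq> j" "\<phi> i = \<phi> j"
        by (auto simp: inj_on_def)
      then show "?F \<phi> = 0" by (simp add: matrix_minor_repeated_row[of i r j])
    qed
  qed (use fin in auto)
  also have "\<dots> = (\<Sum>S\<in>?\<S>. sum ?F {\<phi> \<in> ?\<Phi>. \<phi> ` {0..<r} = S})"
    by (rule sum.group[symmetric]) (use fin finS in \<open>auto simp: card_image\<close>)
  also have "\<dots> = (\<Sum>S\<in>?\<S>. matrix_minor A r f ((!) (sorted_list_of_set S)) *
        matrix_minor B r ((!) (sorted_list_of_set S)) g)"
  proof (rule sum.cong)
    fix S assume S: "S \<in> ?\<S>"
    then have finS': "finite S" by (auto intro: finite_subset)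
    have bij: "bij_betw ((!) (sorted_list_of_set S)) {0..<r} S"
      using S finS' by (intro bij_betw_nth) auto
    have "{\<phi> \<in> ?\<Phi>. \<phi> ` {0..<r} = S} = {\<phi> \<in> {0..<r} \<rightarrow>\<^sub>E S. \<phi> ` {0..<r} = S}"
    proof (intro Collect_cong iffI conjI; elim conjE)
      fix \<phi> assume \<phi>: "\<phi> \<in> {0..<r} \<rightarrow>\<^sub>E S" "\<phi> ` {0..<r} = S"
      have "inj_on \<phi> {0..<r}"
        using S \<phi>(2) by (intro eq_card_imp_inj_on) simp_all
      moreover have "\<phi> \<in> {0..<r} \<rightarrow>\<^sub>E {..<N}"
        using \<phi>(1) S PiE_mono[of "{0..<r}" "\<lambda>_. S" "\<lambda>_. {..<N}"] by blast
      ultimately show "\<phi> \<in> ?\<Phi>" by simp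
    next
      fix \<phi> assume \<phi>: "\<phi> \<in> ?\<Phi>" "\<phi> ` {0..<r} = S"
      then have "\<phi> i \<in> S" if "i \<in> {0..<r}" for i using that by blast
      then show "\<phi> \<in> {0..<r} \<rightarrow>\<^sub>E S" using \<phi>(1) by (simp add: PiE_iff)
    qed
    then show "sum ?F {\<phi> \<in> ?\<Phi>. \<phi> ` {0..<r} = S} =
       matrix_minor A r f ((!) (sorted_list_of_set S)) *
        matrix_minor B r ((!) (sorted_list_of_set S)) g"
      using sum_functions_with_image[OF bij] by simp
  qed simp
  finally show ?thesis .
qed

section \<open>Matrices with all minors in a cone\<close>

text \<open>
  Products of infinite matrices, for the case that each entry is given by a finite sum.  The
  formulation with \<open>eventually\<close> lets a single bound \<open>N\<close> serve for all entries of a minor.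
\<close>

definition is_product ::
  "(nat \<Rightarrow> nat \<Rightarrow> 'a::comm_ring_1) \<Rightarrow> (nat \<Rightarrow> nat \<Rightarrow> 'a) \<Rightarrow> (nat \<Rightarrow> nat \<Rightarrow> 'a) \<Rightarrow> bool" where
  "is_product C A B \<longleftrightarrow> (\<forall>i j. \<forall>\<^sub>F N in sequentially. C i j = (\<Sum>k<N. A i k * B k j))"

lemma is_productI:
  assumes "\<And>i j k. k \<ge> n i j \<Longrightarrow> A i k * B k j = 0"
    and "\<And>i j. C i j = (\<Sum>k<n i j. A i k * B k j)"
  shows "is_product C A B"
  unfolding is_product_def
proof (intro allI eventually_sequentiallyI)
  fix i j N assume "N \<ge> n i j"
  then have "(\<Sum>k<n i j. A i k * B k j) = (\<Sum>k<N. A i k * B k j)"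
    by (intro sum.mono_neutral_left) (auto simp: assms(1))
  then show "C i j = (\<Sum>k<N. A i k * B k j)" by (simp add: assms(2))
qed

lemma is_product_transpose:
  "is_product C A B \<Longrightarrow> is_product (\<lambda>i j. C j i) (\<lambda>i j. B j i) (\<lambda>i j. A j i)"
  unfolding is_product_def by (simp add: mult.commute)

locale positive_cone =
  fixes P :: "'a::comm_ring_1 \<Rightarrow> bool"
  assumes zero: "P 0" and one: "P 1"
    and add: "P a \<Longrightarrow> P b \<Longrightarrow> P (a + b)" and mult: "P a \<Longrightarrow> P b \<Longrightarrow> P (a * b)"
begin

abbreviation tp :: "(nat \<Rightarrow> nat \<Rightarrow> 'a) \<Rightarrow> bool" where
  "tp \<equiv> all_minors P"

lemma sum: "(\<And>i. i \<in> I \<Longrightarrow> P (h i)) \<Longrightarrow> P (sum h I)"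
  by (induction I rule: infinite_finite_induct) (simp_all add: zero add)

lemma of_nat: "P (of_nat n)"
  by (induction n) (simp_all add: zero one add)

lemma tpD:
  "tp A \<Longrightarrow> strict_mono_on {..<r} f \<Longrightarrow> strict_mono_on {..<r} g \<Longrightarrow> P (matrix_minor A r f g)"
  unfolding all_minors_def by blast

lemma tp_transpose: "tp A \<Longrightarrow> tp (\<lambda>i j. A j i)"
  unfolding all_minors_def matrix_minor_transpose[of A] by blast

lemma tp_submatrix:
  assumes "tp A" "strict_mono u" "strict_mono v"
  shows "tp (\<lambda>i j. A (u i) (v j))"
  unfolding all_minors_def
proof (intro allI impI)
  fix r and f g :: "nat \<Rightarrow> nat"
  assume fg: "strict_mono_on {..<r} f" "strict_mono_on {..<r} g"
  have "P (matrix_minor A r (\<lambda>i. u (f i)) (\<lambda>j. v (g j)))"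
    by (rule tpD[OF assms(1)]) (use fg assms(2,3) in \<open>auto simp: strict_mono_on_def strict_mono_def\<close>)
  then show "P (matrix_minor (\<lambda>i j. A (u i) (v j)) r f g)"
    by (simp add: matrix_minor_def)
qed

text \<open>
  The assumption is only about minors that share the rows \<open>f\<close> or the columns \<open>g\<close>.  This is what
  an induction on the rows of a matrix can supply when the matrix is itself a factor.
\<close>

lemma minor_product:
  assumes "is_product C A B"
    and minors: "\<And>e. strict_mono_on {..<r} e \<Longrightarrow> P (matrix_minor A r f e) \<and> P (matrix_minor B r e g)"
  shows "P (matrix_minor C r f g)"
proof -
  have "\<forall>\<^sub>F N in sequentially. \<forall>i\<in>{..<r}. \<forall>j\<in>{..<r}. C (f i) (g j) = (\<Sum>k<N. A (f i) k * B k (g j))"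
    using assms(1) by (intro eventually_ball_finite ballI) (simp_all add: is_product_def)
  then obtain N where
    N: "\<forall>i\<in>{..<r}. \<forall>j\<in>{..<r}. C (f i) (g j) = (\<Sum>k<N. A (f i) k * B k (g j))"
    using eventually_happens'[OF sequentially_bot] by blast
  have "matrix_minor C r f g = matrix_minor (\<lambda>i j. \<Sum>k<N. A i k * B k j) r f g"
    by (rule matrix_minor_cong) (use N in simp)
  also have "P \<dots>"
    unfolding Cauchy_Binet
  proof (rule sum)
    fix S assume S: "S \<in> {S. S \<subseteq> {..<N} \<and> card S = r}"
    have "strict_mono_on {..<r} ((!) (sorted_list_of_set S))"
      using S by (intro strict_mono_onI) (auto intro: sorted_wrt_nth_less[OF strict_sorted_list_of_set])
    then show "P (matrix_minor A r f ((!) (sorted_list_of_set S)) *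
        matrix_minor B r ((!) (sorted_list_of_set S)) g)"
      using minors mult by blast
  qed
  finally show ?thesis .
qed

lemma tp_product: "is_product C A B \<Longrightarrow> tp A \<Longrightarrow> tp B \<Longrightarrow> tp C"
  using minor_product[of C A B] unfolding all_minors_def by meson

lemma strict_mono_on_shift:
  "strict_mono_on {..<Suc r} f \<Longrightarrow> strict_mono_on {..<r} (\<lambda>i. f (Suc i))" for f :: "nat \<Rightarrow> nat"
  by (auto simp: strict_mono_on_def)

lemma strict_mono_on_first_less:
  "strict_mono_on {..<Suc r} f \<Longrightarrow> j < r \<Longrightarrow> f 0 < f (Suc j)" for f :: "nat \<Rightarrow> nat"
  by (auto simp: strict_mono_on_def)

text \<open>
  In a minor of a bidiagonal matrix, the first row or the first column has at most one nonzero
  entry, namely the corner.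
\<close>

lemma tp_bidiagonal:
  assumes "\<And>i. P (a i)" "\<And>i. P (b i)"
  shows "tp (\<lambda>i j. if j = i then a i else if j = Suc i then b i else 0)" (is "tp ?A")
proof -
  have "P (matrix_minor ?A r f g)"
    if "strict_mono_on {..<r} f" "strict_mono_on {..<r} g" for r f g
    using that
  proof (induction r arbitrary: f g)
    case 0
    then show ?case by (simp add: matrix_minor_0 one)
  next
    case (Suc r)
    have f: "\<And>i. i < r \<Longrightarrow> f 0 < f (Suc i)" and g: "\<And>j. j < r \<Longrightarrow> g 0 < g (Suc j)"
      using Suc.prems strict_mono_on_first_less by blast+
    have "matrix_minor ?A (Suc r) f g =
        ?A (f 0) (g 0) * matrix_minor ?A r (\<lambda>i. f (Suc i)) (\<lambda>i. g (Suc i))"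
    proof (cases "g 0 \<le> f 0")
      case True
      show ?thesis
      proof (rule matrix_minor_first_column)
        fix i assume "i < r"
        then show "?A (f (Suc i)) (g 0) = 0" using True f[of i] by simp
      qed
    next
      case False
      show ?thesis
      proof (rule matrix_minor_first_row)
        fix j assume "j < r"
        then show "?A (f 0) (g (Suc j)) = 0" using False g[of j] by simp
      qed
    qed
    moreover have "P (matrix_minor ?A r (\<lambda>i. f (Suc i)) (\<lambda>i. g (Suc i)))"
      using Suc strict_mono_on_shift by blast
    moreover have "P (?A (f 0) (g 0))" using assms zero by simp
    ultimately show ?case using mult by simp
  qed
  then show ?thesis unfolding all_minors_def by blast
qed

lemma tp_scale:
  assumes "tp A" "\<And>i. P (c i)" "\<And>j. P (d j)"
  shows "tp (\<lambda>i j. c i * A i j * d j)"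
proof -
  have diag: "tp (\<lambda>i j. if j = i then c i else 0)" if "\<And>i. P (c i)" for c
    using tp_bidiagonal[of c "\<lambda>_. 0"] that zero by (simp cong: if_cong)
  have "is_product (\<lambda>i j. c i * A i j) (\<lambda>i j. if j = i then c i else 0) A"
    by (rule is_productI[where n = "\<lambda>i j. Suc i"]) auto
  then have "tp (\<lambda>i j. c i * A i j)" using diag[of c] assms tp_product by blast
  moreover have "is_product (\<lambda>i j. c i * A i j * d j) (\<lambda>i j. c i * A i j) (\<lambda>i j. if j = i then d i else 0)"
    by (rule is_productI[where n = "\<lambda>i j. Suc j"]) auto
  ultimately show ?thesis using diag[of d] assms tp_product by blast
qed

text \<open>
  A minor that avoids row \<open>0\<close> is a minor of \<open>A Q\<close> with all row indices lowered by one, so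
  Cauchy-Binet and induction on the largest row apply.  A minor that uses row \<open>0\<close>, which is the
  first unit vector, reduces to the smaller minor without it.
\<close>

lemma tp_iterate_rows:
  assumes "tp Q" "\<And>k. A 0 k = (if k = 0 then 1 else 0)" "is_product (\<lambda>n. A (Suc n)) A Q"
  shows "tp A"
proof -
  have "P (matrix_minor A r f g)"
    if "strict_mono_on {..<r} f" "strict_mono_on {..<r} g" "\<forall>i<r. f i < N" for r f g N
    using that
  proof (induction N arbitrary: r f g)
    case 0
    then show ?case by (cases r) (auto simp: matrix_minor_0 one)
  next
    case (Suc N)
    have positive_rows: "P (matrix_minor A r f g)"
      if fg: "strict_mono_on {..<r} f" "strict_mono_on {..<r} g" "\<forall>i<r. 0 < f i \<and> f i < Suc N" for r f g
    proof -
      have "strict_mono_on {..<r} (\<lambda>i. f i - 1)"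
        unfolding strict_mono_on_def
      proof (intro allI impI, elim conjE)
        fix i j assume "i \<in> {..<r}" "j \<in> {..<r}" "i < j"
        then have "f i < f j" "0 < f i" using fg by (auto simp: strict_mono_on_def)
        then show "f i - 1 < f j - 1" by arith
      qed
      moreover have "\<forall>i<r. f i - 1 < N" using fg(3) by force
      ultimately have "P (matrix_minor (\<lambda>n. A (Suc n)) r (\<lambda>i. f i - 1) g)"
        by (intro minor_product[OF assms(3)] conjI Suc.IH tpD[OF assms(1)] fg(2))
      moreover have "matrix_minor (\<lambda>n. A (Suc n)) r (\<lambda>i. f i - 1) g = matrix_minor A r f g"
        by (rule matrix_minor_cong) (use fg(3) in simp)
      ultimately show ?thesis by simp
    qed
    show ?case
    proof (cases "r = 0 \<or> f 0 > 0")
      case True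
      have "0 < f i" if "i < r" for i
      proof (cases "i = 0")
        case False
        then have "f 0 < f i" using that Suc.prems(1) by (auto simp: strict_mono_on_def)
        then show ?thesis by simp
      qed (use True that in auto)
      then show ?thesis using Suc.prems by (intro positive_rows) auto
    next
      case False
      then obtain s where r: "r = Suc s" and f0: "f 0 = 0" by (cases r) auto
      have g: "\<And>j. j < s \<Longrightarrow> g 0 < g (Suc j)" and f: "\<And>j. j < s \<Longrightarrow> f 0 < f (Suc j)"
        using Suc.prems strict_mono_on_first_less r by blast+
      have "matrix_minor A r f g = A (f 0) (g 0) * matrix_minor A s (\<lambda>i. f (Suc i)) (\<lambda>i. g (Suc i))"
        unfolding r
      proof (rule matrix_minor_first_row)
        fix j assume "j < s"
        then show "A (f 0) (g (Suc j)) = 0" using g[of j] by (simp add: f0 assms(2))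
      qed
      moreover have "P (matrix_minor A s (\<lambda>i. f (Suc i)) (\<lambda>i. g (Suc i)))"
        using Suc.prems f by (intro positive_rows strict_mono_on_shift) (auto simp: r f0)
      moreover have "P (A (f 0) (g 0))" by (simp add: f0 assms(2) zero one)
      ultimately show ?thesis using mult by simp
    qed
  qed
  moreover have "\<exists>N. \<forall>i<r. f i < N" for r and f :: "nat \<Rightarrow> nat"
    by (rule exI[of _ "Suc (Max (f ` {..<r}))"]) (auto simp: less_Suc_eq_le)
  ultimately show ?thesis unfolding all_minors_def by blast
qed

lemma tp_iterate_columns:
  assumes "tp Q" "\<And>k. A k 0 = (if k = 0 then 1 else 0)" "is_product (\<lambda>k j. A k (Suc j)) Q A"
  shows "tp A"
proof -
  have "tp (\<lambda>i j. A j i)"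
    by (rule tp_iterate_rows[OF tp_transpose[OF assms(1)] assms(2) is_product_transpose[OF assms(3)]])
  then show ?thesis by (rule tp_transpose)
qed

text \<open>
  Let \<open>V\<close> be the matrix whose columns arise from the first unit vector by repeated multiplication
  with \<open>Q\<close>.  Moving one factor \<open>Q\<close> from \<open>V\<close> to \<open>A\<close> lowers the column index of \<open>V\<close> and raises the row
  index of \<open>A\<close> by one, so that the Hankel matrix equals \<open>A V\<close>.
\<close>

theorem tp_output_matrix_Hankel:
  assumes Q: "tp Q" "\<And>k l. l > Suc k \<Longrightarrow> Q k l = 0"
    and A0: "\<And>k. A 0 k = (if k = 0 then 1 else 0)" and A_lower: "\<And>n k. k > n \<Longrightarrow> A n k = 0"
    and A_Suc: "\<And>n k. A (Suc n) k = (\<Sum>j\<le>n. A n j * Q j k)"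
  shows "tp A" "tp (\<lambda>i j. A (i + j) 0)"
proof -
  have "is_product (\<lambda>n. A (Suc n)) A Q"
    by (rule is_productI[where n = "\<lambda>i j. Suc i"]) (simp_all add: A_lower A_Suc lessThan_Suc_atMost)
  then show tpA: "tp A" using tp_iterate_rows Q(1) A0 by blast
  define W where "W = rec_nat (\<lambda>k. if k = 0 then 1 else 0) (\<lambda>_ w k. \<Sum>l\<le>Suc k. Q k l * w l)"
  define V where "V k j = W j k" for k j
  have V0: "V k 0 = (if k = 0 then 1 else 0)" for k
    by (simp add: V_def W_def)
  have V_Suc: "V k (Suc j) = (\<Sum>l\<le>Suc k. Q k l * V l j)" for k j
    by (simp add: V_def W_def)
  have "is_product (\<lambda>k j. V k (Suc j)) Q V"
    by (rule is_productI[where n = "\<lambda>k j. Suc (Suc k)"])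
      (use Q(2) in \<open>simp_all add: V_Suc lessThan_Suc_atMost del: sum.atMost_Suc\<close>)
  then have tpV: "tp V" using tp_iterate_columns Q(1) V0 by blast
  have hankel: "A (i + j) 0 = (\<Sum>k\<le>i. A i k * V k j)" for i j
  proof (induction j arbitrary: i)
    case 0
    show ?case by (simp add: V0 sum.delta if_distrib[of "\<lambda>x. _ * x"] cong: if_cong)
  next
    case (Suc j)
    have "(\<Sum>k\<le>i. A i k * V k (Suc j)) = (\<Sum>k\<le>i. \<Sum>l\<le>Suc i. A i k * Q k l * V l j)"
    proof (rule sum.cong)
      fix k assume "k \<in> {..i}"
      then have "V k (Suc j) = (\<Sum>l\<le>Suc i. Q k l * V l j)"
        unfolding V_Suc by (intro sum.mono_neutral_left) (auto simp: Q(2))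
      then show "A i k * V k (Suc j) = (\<Sum>l\<le>Suc i. A i k * Q k l * V l j)"
        by (simp only: sum_distrib_left mult.assoc)
    qed simp
    also have "\<dots> = (\<Sum>l\<le>Suc i. A (Suc i) l * V l j)"
      by (subst sum.swap) (simp only: A_Suc sum_distrib_right)
    finally show ?case using Suc[of "Suc i"] by simp
  qed
  have "is_product (\<lambda>i j. A (i + j) 0) A V"
    by (rule is_productI[where n = "\<lambda>i j. Suc i"])
      (simp_all add: A_lower hankel lessThan_Suc_atMost)
  then show "tp (\<lambda>i j. A (i + j) 0)" using tpA tpV tp_product by blast
qed

end

section \<open>The Abel matrix\<close>

context positive_cone
begin

text \<open>
  The Pascal rule says that each row arises from the one before by a bidiagonal matrix.
\<close>

lemma tp_Pascal:
  assumes y: "P y"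
  shows "tp (\<lambda>n k. of_nat (n choose k) * y ^ (n - k))" (is "tp ?L")
proof (rule tp_iterate_rows)
  let ?Q = "\<lambda>i j. if j = i then y else if j = Suc i then 1 else 0"
  show "tp ?Q" by (rule tp_bidiagonal) (simp_all add: y one)
  show "?L 0 k = (if k = 0 then 1 else 0)" for k by (cases k) simp_all
  have step: "?L (Suc n) k = y * ?L n k + (if k = 0 then 0 else ?L n (k - 1))" for n k
  proof (cases k)
    case (Suc l)
    then show ?thesis
    proof (cases "Suc l \<le> n")
      case True
      then have "n - l = Suc (n - Suc l)" by simp
      then show ?thesis by (simp add: Suc algebra_simps)
    qed (simp add: Suc binomial_eq_0)
  qed simp
  show "is_product (\<lambda>n. ?L (Suc n)) ?L ?Q"
  proof (rule is_productI[where n = "\<lambda>i j. Suc (Suc i)"])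
    show "?L (Suc i) j = (\<Sum>k<Suc (Suc i). ?L i k * ?Q k j)" for i j
    proof -
      have "(\<Sum>k<Suc (Suc i). ?L i k * ?Q k j) =
        (\<Sum>k<Suc (Suc i). (if k = j then ?L i k * y else 0) +
           (if k = j - 1 then if j = 0 then 0 else ?L i k else 0))"
        by (rule sum.cong) auto
      also have "\<dots> = (if j < Suc (Suc i) then ?L i j * y else 0) +
          (if j - 1 < Suc (Suc i) then if j = 0 then 0 else ?L i (j - 1) else 0)"
        by (simp only: sum.distrib sum.delta finite_lessThan lessThan_iff)
      also have "\<dots> = ?L (Suc i) j"
        unfolding step[of i j] by (auto simp: mult.commute binomial_eq_0)
      finally show ?thesis by (rule sym)
    qed
  qed (auto simp: binomial_eq_0)
qed

text \<open>
  Rows \<open>0\<close> to \<open>N\<close> of \<open>M\<close>, completed by the identity, form a finite product of elementary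
  bidiagonal matrices: the factor number \<open>N + 1\<close> adds \<open>c N\<close> times row \<open>N\<close> to row \<open>N + 1\<close>.
\<close>

lemma tp_first_order_recurrence:
  assumes M0: "\<And>k. M 0 k = (if k = 0 then 1 else 0)"
    and M_Suc: "\<And>n k. M (Suc n) k = c n * M n k + (if k = Suc n then 1 else 0)"
    and c: "\<And>n. P (c n)"
  shows "tp M"
proof -
  define T where "T N n k = (if n \<le> N then M n k else if k = n then 1 else 0)" for N n k
  have "tp (T N)" for N
  proof (induction N)
    case 0
    have "T 0 = (\<lambda>i j. if j = i then 1 else if j = Suc i then 0 else 0)"
      by (auto simp: T_def M0 fun_eq_iff)
    then show ?case using tp_bidiagonal[of "\<lambda>_. 1" "\<lambda>_. 0"] one zero by simp
  next
    case (Suc N)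
    let ?E = "\<lambda>j i. if j = i then 1 else if j = Suc i then if i = N then c N else 0 else 0"
    have "tp ?E"
      by (intro tp_transpose[OF tp_bidiagonal]) (simp_all add: one zero c)
    moreover have "is_product (T (Suc N)) ?E (T N)"
    proof (rule is_productI[where n = "\<lambda>i j. Suc i"])
      show "T (Suc N) i j = (\<Sum>k<Suc i. ?E i k * T N k j)" for i j
      proof -
        have "(\<Sum>k<Suc i. ?E i k * T N k j) =
            (\<Sum>k<Suc i. if k = i then T N k j else 0) +
            (\<Sum>k<Suc i. if k = N then if i = Suc N then c N * T N k j else 0 else 0)"
          unfolding sum.distrib[symmetric] by (rule sum.cong) auto
        also have "\<dots> = T N i j + (if N < Suc i then if i = Suc N then c N * T N N j else 0 else 0)"
          by (simp only: sum.delta finite_lessThan lessThan_iff if_True lessI)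
        also have "\<dots> = T (Suc N) i j"
        proof (cases "i = Suc N")
          case True
          then show ?thesis by (simp add: T_def M_Suc)
        qed (auto simp: T_def)
        finally show ?thesis by (rule sym)
      qed
    qed auto
    ultimately show ?case using Suc tp_product by blast
  qed
  moreover have "\<exists>N. matrix_minor M r f g = matrix_minor (T N) r f g" for r f g
  proof (intro exI matrix_minor_cong)
    fix i j assume "i < r"
    then show "M (f i) (g j) = T (Max (f ` {..<r})) (f i) (g j)" by (simp add: T_def)
  qed
  ultimately show ?thesis unfolding all_minors_def by metis
qed

text \<open>
  The entry \<open>binomial(n, k) (n - k)!\<close> is \<open>n! / k!\<close> for \<open>k \<le> n\<close>, in a form that makes sense in
  every ring and vanishes for \<open>k > n\<close>.
\<close>

lemma tp_falling_factorials:
  assumes y: "P y"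
  shows "tp (\<lambda>n k. of_nat ((n choose k) * fact (n - k)) * y ^ (n - k))" (is "tp ?F")
proof (rule tp_first_order_recurrence)
  show "?F 0 k = (if k = 0 then 1 else 0)" for k by (cases k) simp_all
  show "?F (Suc n) k = of_nat (Suc n) * y * ?F n k + (if k = Suc n then 1 else 0)" for n k
  proof (cases "k \<le> n")
    case True
    then have "(Suc n choose k) * fact (Suc n - k) = Suc n * ((n choose k) * fact (n - k))"
    proof -
      have "fact k * (Suc n * ((n choose k) * fact (n - k))) =
          Suc n * (fact k * fact (n - k) * (n choose k))"
        by (simp only: mult_ac)
      also have "\<dots> = fact (Suc n)"
        using binomial_fact_lemma[of k n] True by simp
      also have "\<dots> = fact k * fact (Suc n - k) * (Suc n choose k)"
        by (rule binomial_fact_lemma[symmetric]) (use True in simp)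
      finally have "fact k * ((Suc n choose k) * fact (Suc n - k)) =
          fact k * (Suc n * ((n choose k) * fact (n - k)))"
        by (simp only: mult_ac)
      then show ?thesis by simp
    qed
    then show ?thesis using True by (simp only: Suc_diff_le power_Suc of_nat_mult) simp
  next
    case False
    then show ?thesis by (cases "k = Suc n") (simp_all add: binomial_eq_0)
  qed
  show "P (of_nat (Suc n) * y)" for n by (intro mult of_nat y)
qed

end

text \<open>
  The trinomial revision \<open>binomial(n, k) binomial(k, j) = binomial(n, j) binomial(n-j, k-j)\<close>, summed
  over \<open>k\<close>.
\<close>

lemma sum_choose_choose:
  fixes h :: "nat \<Rightarrow> 'a::comm_ring_1"
  shows "(\<Sum>k\<le>n. of_nat (n choose k) * of_nat (k choose j) * h k) =
    of_nat (n choose j) * (\<Sum>i\<le>n - j. of_nat ((n - j) choose i) * h (j + i))"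
proof (cases "j \<le> n")
  case True
  have "(\<Sum>k\<le>n. of_nat (n choose k) * of_nat (k choose j) * h k) =
      (\<Sum>k\<in>{j..n}. of_nat (n choose k) * of_nat (k choose j) * h k)"
    by (rule sum.mono_neutral_right) (auto simp: binomial_eq_0)
  also have "\<dots> = (\<Sum>i\<le>n - j. of_nat (n choose (j + i)) * of_nat ((j + i) choose j) * h (j + i))"
    by (rule sum.reindex_bij_witness[where i = "\<lambda>i. j + i" and j = "\<lambda>k. k - j"]) (use True in auto)
  also have "\<dots> = (\<Sum>i\<le>n - j. of_nat (n choose j) * (of_nat ((n - j) choose i) * h (j + i)))"
  proof (rule sum.cong)
    fix i assume "i \<in> {..n - j}"
    then have "(n choose (j + i)) * ((j + i) choose j) = (n choose j) * ((n - j) choose i)"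
      using True choose_mult[of j "j + i" n] by simp
    then show "of_nat (n choose (j + i)) * of_nat ((j + i) choose j) * h (j + i) =
        of_nat (n choose j) * (of_nat ((n - j) choose i) * h (j + i))"
      by (simp only: of_nat_mult[symmetric] mult.assoc[symmetric])
  qed simp
  finally show ?thesis by (simp only: sum_distrib_left)
next
  case False
  then have "(\<Sum>k\<le>n. of_nat (n choose k) * of_nat (k choose j) * h k) = 0"
    by (intro sum.neutral) (auto simp: binomial_eq_0)
  then show ?thesis using False by (simp add: binomial_eq_0)
qed

text \<open>
  Up to cancellation, \<open>binomial(n, k) (x + k y) (x + n y)^(n-k-1)\<close>; written as a difference, the
  entry is a polynomial in \<open>x\<close> and \<open>y\<close> also for \<open>k = n\<close>.  For \<open>y = 1\<close> it is
  \<open>n!/k!\<close> times the coefficient of \<open>z^n\<close> in \<open>exp (x T(z)) T(z)^k\<close>, by Lagrange inversion.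
\<close>

definition Abel_matrix :: "'a::comm_ring_1 \<Rightarrow> 'a \<Rightarrow> nat \<Rightarrow> nat \<Rightarrow> 'a" where
  "Abel_matrix x y n k = of_nat (n choose k) *
     ((x + of_nat n * y) ^ (n - k) - of_nat (n - k) * y * (x + of_nat n * y) ^ (n - k - 1))"

lemma binomial_absorb_complement: "(n choose k) * (n - k) = n * ((n - 1) choose k)"
proof (cases "n = 0")
  case False
  then show ?thesis using binomial_absorb_comp[of n k] by (simp add: mult.commute)
qed simp

text \<open>
  In terms of generating functions, and for \<open>y = 1\<close>, the Pascal matrix multiplies \<open>exp (x T)\<close> by
  \<open>exp T\<close>.  The proof is the binomial theorem, applied to both parts of the difference.
\<close>

lemma Abel_times_Pascal:
  "(\<Sum>k\<le>n. Abel_matrix x y n k * (of_nat (k choose j) * y ^ (k - j))) = Abel_matrix (x + y) y n j"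
proof -
  let ?c = "x + of_nat n * y" and ?m = "n - j"
  let ?h = "\<lambda>k. (?c ^ (n - k) - of_nat (n - k) * y * ?c ^ (n - k - 1)) * y ^ (k - j)"
  have "(\<Sum>k\<le>n. Abel_matrix x y n k * (of_nat (k choose j) * y ^ (k - j))) =
      (\<Sum>k\<le>n. of_nat (n choose k) * of_nat (k choose j) * ?h k)"
    by (simp only: Abel_matrix_def mult_ac)
  also have "\<dots> = of_nat (n choose j) * (\<Sum>i\<le>?m. of_nat (?m choose i) * ?h (j + i))"
    by (rule sum_choose_choose)
  also have "(\<Sum>i\<le>?m. of_nat (?m choose i) * ?h (j + i)) =
      (\<Sum>i\<le>?m. of_nat (?m choose i) * y ^ i * ?c ^ (?m - i)) -
      (\<Sum>i\<le>?m. of_nat ((?m choose i) * (?m - i)) * y ^ i * ?c ^ (?m - i - 1) * y)"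
    unfolding sum_subtractf[symmetric]
    by (rule sum.cong) (simp_all add: right_diff_distrib left_diff_distrib mult_ac)
  also have "(\<Sum>i\<le>?m. of_nat (?m choose i) * y ^ i * ?c ^ (?m - i)) = (y + ?c) ^ ?m"
    by (rule binomial_ring[symmetric])
  also have "(\<Sum>i\<le>?m. of_nat ((?m choose i) * (?m - i)) * y ^ i * ?c ^ (?m - i - 1) * y) =
      of_nat ?m * y * (\<Sum>i\<le>?m. of_nat ((?m - 1) choose i) * y ^ i * ?c ^ (?m - 1 - i))"
    unfolding sum_distrib_left binomial_absorb_complement
    by (rule sum.cong) (simp_all add: mult_ac diff_commute)
  also have "\<dots> = of_nat ?m * y * (\<Sum>i\<le>?m - 1. of_nat ((?m - 1) choose i) * y ^ i * ?c ^ (?m - 1 - i))"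
  proof (rule arg_cong[where f = "\<lambda>t. _ * t"], rule sum.mono_neutral_right)
    show "\<forall>i\<in>{..?m} - {..?m - 1}. of_nat ((?m - 1) choose i) * y ^ i * ?c ^ (?m - 1 - i) = 0"
      by (auto simp: binomial_eq_0)
  qed auto
  also have "\<dots> = of_nat ?m * y * (y + ?c) ^ (?m - 1)"
    by (simp only: binomial_ring)
  finally show ?thesis
    by (simp only: Abel_matrix_def) (simp add: algebra_simps)
qed

text \<open>
  For \<open>y = 1\<close>, this factor divides the generating functions by \<open>1 - T\<close>, which removes the correction
  term of Lagrange inversion.  The sum telescopes.
\<close>

lemma Abel_times_falling_factorials:
  "(\<Sum>k\<le>n. Abel_matrix x y n k * (of_nat ((k choose j) * fact (k - j)) * y ^ (k - j))) =
    of_nat (n choose j) * (x + of_nat n * y) ^ (n - j)"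
proof -
  let ?c = "x + of_nat n * y" and ?m = "n - j"
  let ?h = "\<lambda>k. (?c ^ (n - k) - of_nat (n - k) * y * ?c ^ (n - k - 1)) * (of_nat (fact (k - j)) * y ^ (k - j))"
  let ?t = "\<lambda>i. of_nat ((?m choose i) * fact i) * y ^ i * ?c ^ (?m - i)"
  have "(\<Sum>k\<le>n. Abel_matrix x y n k * (of_nat ((k choose j) * fact (k - j)) * y ^ (k - j))) =
      (\<Sum>k\<le>n. of_nat (n choose k) * of_nat (k choose j) * ?h k)"
    by (simp only: Abel_matrix_def mult_ac of_nat_mult)
  also have "\<dots> = of_nat (n choose j) * (\<Sum>i\<le>?m. of_nat (?m choose i) * ?h (j + i))"
    by (rule sum_choose_choose)
  also have "(\<Sum>i\<le>?m. of_nat (?m choose i) * ?h (j + i)) = (\<Sum>i\<le>?m. ?t i - ?t (Suc i))"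
  proof (rule sum.cong)
    fix i
    have "(?m choose i) * (?m - i) * fact i = (?m choose Suc i) * fact (Suc i)"
    proof -
      have "(?m choose i) * (?m - i) = Suc i * (?m choose Suc i)"
        using Suc_times_binomial[of i "?m - 1"] binomial_absorb_complement[of ?m i]
        by (cases ?m) (simp_all only: binomial_0_Suc mult_0 mult_0_right diff_0_eq_0 diff_Suc_1)
      then show ?thesis by (simp only: fact_Suc of_nat_id mult_ac)
    qed
    then have "of_nat (?m choose i) * of_nat (?m - i) * of_nat (fact i) =
        (of_nat ((?m choose Suc i) * fact (Suc i)) :: 'a)"
      by (simp only: of_nat_mult[symmetric])
    then have "?t (Suc i) = of_nat (?m choose i) * of_nat (?m - i) * of_nat (fact i) * y ^ Suc i * ?c ^ (?m - Suc i)"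
      by simp
    then show "of_nat (?m choose i) * ?h (j + i) = ?t i - ?t (Suc i)"
      by (simp add: algebra_simps)
  qed simp
  also have "\<dots> = ?t 0 - ?t (Suc ?m)"
    by (induction rule: sum_telescope)
  finally show ?thesis by (simp add: binomial_eq_0)
qed

text \<open>
  The ring identity behind the recurrence below, with \<open>p = a + b\<close> the Pascal rule and
  \<open>p q = b N\<close> the absorption identity of binomial coefficients.
\<close>

lemma Pascal_rule_combination:
  fixes p q a b :: "'a::comm_ring_1"
  assumes "p * q = b * N" "p = a + b"
  shows "p * (d * (x + N * y) - q * y * d) = b * d * x + a * (d * (x + N * y))"
proof -
  have "p * (d * (x + N * y) - q * y * d) = p * (d * (x + N * y)) - p * q * (y * d)"
    by (simp add: algebra_simps)
  also have "\<dots> = (a + b) * (d * (x + N * y)) - b * N * (y * d)"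
    by (simp only: assms(1)) (simp only: assms(2))
  finally show ?thesis by (simp add: algebra_simps)
qed

text \<open>
  The right-hand side is row \<open>n\<close> of the matrix \<open>binomial(n, k) (x + (n + 1) y)^(n-k)\<close> times the bidiagonal
  matrix with \<open>x\<close> on the diagonal and \<open>1\<close> above it.
\<close>

lemma Abel_matrix_Suc:
  "Abel_matrix x y (Suc n) k =
     of_nat (n choose k) * (x + of_nat (Suc n) * y) ^ (n - k) * x +
     (if k = 0 then 0 else of_nat (n choose (k - 1)) * (x + of_nat (Suc n) * y) ^ (n - (k - 1)))"
proof (cases k)
  case 0
  then show ?thesis by (simp add: Abel_matrix_def algebra_simps)
next
  case (Suc l)
  let ?c = "x + of_nat (Suc n) * y"
  show ?thesis
  proof (cases "l < n")
    case True
    define d where "d = ?c ^ (n - Suc l)"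
    have c: "?c ^ (n - l) = d * ?c"
      using True by (simp add: d_def Suc_diff_Suc[symmetric] del: of_nat_Suc)
    have "of_nat (Suc n choose Suc l) * of_nat (n - l) = (of_nat (n choose Suc l) * of_nat (Suc n) :: 'a)"
      using binomial_absorb_complement[of "Suc n" "Suc l"]
      by (simp only: of_nat_mult[symmetric] mult.commute diff_Suc_Suc diff_Suc_1)
    moreover have "(of_nat (Suc n choose Suc l) :: 'a) = of_nat (n choose l) + of_nat (n choose Suc l)"
      by simp
    ultimately have "of_nat (Suc n choose Suc l) * (d * ?c - of_nat (n - l) * y * d) =
        of_nat (n choose Suc l) * d * x + of_nat (n choose l) * (d * ?c)"
      by (rule Pascal_rule_combination)
    then show ?thesis
      by (simp only: Suc Abel_matrix_def diff_Suc_Suc diff_Suc_1 c d_def[symmetric] One_nat_def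
          diff_diff_left add_Suc_right add_0_right nat.distinct if_False minus_nat.diff_0)
  next
    case False
    then show ?thesis by (cases "l = n") (simp_all add: Suc Abel_matrix_def binomial_eq_0)
  qed
qed

context positive_cone
begin

text \<open>
  By the two product formulas, \<open>Abel_matrix x y\<close> times the Pascal matrix times the matrix of
  falling factorials has entries \<open>binomial(n, k) (x + (n + 1) y)^(n-k)\<close>.  Multiplication with the
  bidiagonal matrix \<open>?B\<close> then gives row \<open>n + 1\<close> of \<open>Abel_matrix x y\<close>, so the product of the three
  factors is the production matrix \<open>Q\<close>.
\<close>

theorem tp_Abel_matrix:
  assumes x: "P x" and y: "P y"
  shows "tp (Abel_matrix x y)" "tp (\<lambda>i j. Abel_matrix x y (i + j) 0)"
proof -
  let ?L = "\<lambda>n k. of_nat (n choose k) * y ^ (n - k)"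
  let ?F = "\<lambda>n k. of_nat ((n choose k) * fact (n - k)) * y ^ (n - k)"
  let ?B = "\<lambda>i j. if j = i then x else if j = Suc i then 1 else 0"
  define G where "G j k = (\<Sum>i\<le>j. ?L j i * ?F i k)" for j k
  define Q where "Q j k = G j k * x + (if k = 0 then 0 else G j (k - 1))" for j k
  have G_lower: "G j k = 0" if "k > j" for j k
    unfolding G_def using that by (intro sum.neutral) (auto simp: binomial_eq_0)
  have "is_product G ?L ?F"
    by (rule is_productI[where n = "\<lambda>i j. Suc i"])
      (simp_all add: G_def lessThan_Suc_atMost binomial_eq_0)
  then have "tp G"
    using tp_Pascal[OF y] tp_falling_factorials[OF y] tp_product by blast
  moreover have "is_product Q G ?B"
  proof (rule is_productI[where n = "\<lambda>i j. Suc j"])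
    show "Q i j = (\<Sum>k<Suc j. G i k * ?B k j)" for i j
    proof -
      have "(\<Sum>k<Suc j. G i k * ?B k j) =
        (\<Sum>k<Suc j. (if k = j then G i k * x else 0)) +
        (\<Sum>k<Suc j. (if k = j - 1 then if j = 0 then 0 else G i k else 0))"
        unfolding sum.distrib[symmetric] by (rule sum.cong) auto
      also have "\<dots> = Q i j"
        unfolding Q_def by (simp only: sum.delta finite_lessThan lessThan_iff) simp
      finally show ?thesis by (rule sym)
    qed
  qed auto
  moreover have "tp ?B" by (rule tp_bidiagonal) (simp_all add: x one)
  ultimately have tpQ: "tp Q" using tp_product by blast
  have Q_lower: "Q k l = 0" if "l > Suc k" for k l
    using that by (simp add: Q_def G_lower)
  have A0: "Abel_matrix x y 0 k = (if k = 0 then 1 else 0)" for k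
    by (cases k) (simp_all add: Abel_matrix_def)
  have A_lower: "Abel_matrix x y n k = 0" if "k > n" for n k
    using that by (simp add: Abel_matrix_def binomial_eq_0)
  have AG: "(\<Sum>j\<le>n. Abel_matrix x y n j * G j k) =
      of_nat (n choose k) * (x + of_nat (Suc n) * y) ^ (n - k)" for n k
  proof -
    have "(\<Sum>j\<le>n. Abel_matrix x y n j * G j k) =
        (\<Sum>j\<le>n. \<Sum>i\<le>n. Abel_matrix x y n j * ?L j i * ?F i k)"
    proof (rule sum.cong)
      fix j assume "j \<in> {..n}"
      then have "G j k = (\<Sum>i\<le>n. ?L j i * ?F i k)"
        unfolding G_def by (intro sum.mono_neutral_left) (auto simp: binomial_eq_0)
      then show "Abel_matrix x y n j * G j k = (\<Sum>i\<le>n. Abel_matrix x y n j * ?L j i * ?F i k)"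
        by (simp only: sum_distrib_left mult.assoc)
    qed simp
    also have "\<dots> = (\<Sum>i\<le>n. (\<Sum>j\<le>n. Abel_matrix x y n j * ?L j i) * ?F i k)"
      by (subst sum.swap) (simp only: sum_distrib_right)
    also have "\<dots> = of_nat (n choose k) * (x + y + of_nat n * y) ^ (n - k)"
      by (simp only: Abel_times_Pascal Abel_times_falling_factorials)
    finally show ?thesis by (simp add: algebra_simps)
  qed
  have A_Suc: "Abel_matrix x y (Suc n) k = (\<Sum>j\<le>n. Abel_matrix x y n j * Q j k)" for n k
  proof -
    have "(\<Sum>j\<le>n. Abel_matrix x y n j * Q j k) =
        (\<Sum>j\<le>n. Abel_matrix x y n j * G j k) * x +
        (if k = 0 then 0 else \<Sum>j\<le>n. Abel_matrix x y n j * G j (k - 1))"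
      unfolding Q_def by (simp add: distrib_left sum.distrib sum_distrib_right mult.assoc)
    then show ?thesis by (simp only: AG Abel_matrix_Suc)
  qed
  show "tp (Abel_matrix x y)" "tp (\<lambda>i j. Abel_matrix x y (i + j) 0)"
    using tp_output_matrix_Hankel[of Q "Abel_matrix x y"] tpQ Q_lower A0 A_lower A_Suc by blast+
qed

end

section \<open>Total positivity and log-convexity over the reals and over polynomials\<close>

interpretation real_cone: positive_cone "\<lambda>d::real. 0 \<le> d"
  by unfold_locales auto

interpretation poly_cone: positive_cone nonneg_coeffs
  by unfold_locales
    (auto simp: nonneg_coeffs_def Polynomial.coeff_1 coeff_mult intro!: sum_nonneg mult_nonneg_nonneg)

text \<open>
  The factor \<open>k!\<close> makes the column generating functions \<open>(z exp z)^k\<close> multiplicative.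
  Multiplication with \<open>z exp z\<close> acts on a column as \<open>?Q\<close>, a shifted and rescaled Pascal matrix.
\<close>

lemma totally_positive_idempotent_factorial:
  "totally_positive (\<lambda>n k. real (n choose k) * real k ^ (n - k) * fact k)" (is "totally_positive ?A")
  unfolding totally_positive_def
proof (rule real_cone.tp_iterate_columns)
  let ?S = "\<lambda>n m. if n = m then 0 else if n = Suc m then real (Suc m) else 0"
  let ?L = "\<lambda>n k. of_nat (n choose k) * (1::real) ^ (n - k)"
  let ?Q = "\<lambda>n l. real n * real ((n - 1) choose l)"
  have "real_cone.tp ?S"
    by (rule real_cone.tp_transpose, rule real_cone.tp_bidiagonal) auto
  moreover have "real_cone.tp ?L" by (rule real_cone.tp_Pascal) simp
  moreover have "is_product ?Q ?S ?L"
  proof (rule is_productI[where n = "\<lambda>i j. i"])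
    show "?Q i j = (\<Sum>k<i. ?S i k * ?L k j)" for i j
      by (cases i) simp_all
  qed auto
  ultimately show "real_cone.tp ?Q" using real_cone.tp_product by blast
  show "?A k 0 = (if k = 0 then 1 else 0)" for k by simp
  show "is_product (\<lambda>k j. ?A k (Suc j)) ?Q ?A"
  proof (rule is_productI[where n = "\<lambda>i j. i"])
    fix n k :: nat
    show "?A n (Suc k) = (\<Sum>l<n. ?Q n l * ?A l k)"
    proof (cases n)
      case (Suc m)
      have "(\<Sum>l<n. ?Q n l * ?A l k) =
          real n * fact k * (\<Sum>l\<le>m. real (m choose l) * real (l choose k) * real k ^ (l - k))"
        by (simp add: Suc lessThan_Suc_atMost sum_distrib_left mult_ac del: sum.atMost_Suc)
      also have "\<dots> = real n * fact k * (real (m choose k) * (real k + 1) ^ (m - k))"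
        by (simp add: sum_choose_choose binomial_ring)
      also have "\<dots> = real (Suc m * (m choose k)) * fact k * (real k + 1) ^ (m - k)"
        by (simp only: Suc of_nat_mult mult_ac)
      also have "\<dots> = ?A n (Suc k)"
        unfolding Suc_times_binomial[symmetric] by (simp add: Suc algebra_simps del: binomial_Suc_Suc)
      finally show ?thesis by (rule sym)
    qed simp
  qed (auto simp: binomial_eq_0)
qed

lemma totally_positive_idempotent:
  "totally_positive (\<lambda>n k. real (n choose k) * real k ^ (n - k))"
  using real_cone.tp_scale[OF totally_positive_idempotent_factorial[unfolded totally_positive_def],
      of "\<lambda>_. 1" "\<lambda>k. 1 / fact k"]
  by (simp add: totally_positive_def)

lemma Abel_matrix_0_1:
  "Abel_matrix 0 (1::real) (Suc i) (Suc j) = real (i choose j) * real (Suc i) ^ (i - j)"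
proof (cases "j < i")
  case True
  define d where "d = real (Suc i) ^ (i - Suc j)"
  have pow: "real (Suc i) ^ (i - j) = d * real (Suc i)"
    using True by (simp add: d_def Suc_diff_Suc[symmetric] del: of_nat_Suc)
  have "real (Suc j * (Suc i choose Suc j)) = real (Suc i * (i choose j))"
    by (simp only: Suc_times_binomial)
  then have absorb: "real (Suc j) * real (Suc i choose Suc j) = real (Suc i) * real (i choose j)"
    by (simp only: of_nat_mult)
  have "real (i - j) = real (Suc i) - real (Suc j)" using True by simp
  then have "real (Suc i choose Suc j) * (d * real (Suc i) - real (i - j) * d) =
      d * (real (Suc j) * real (Suc i choose Suc j))"
    by (simp only:) (simp only: algebra_simps)
  also have "\<dots> = real (i choose j) * (d * real (Suc i))"
    unfolding absorb by (simp only: mult_ac)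
  finally have "real (Suc i choose Suc j) * (d * real (Suc i) - real (i - j) * d) =
      real (i choose j) * (d * real (Suc i))" .
  then show ?thesis
    by (simp add: Abel_matrix_def pow d_def[symmetric] del: of_nat_Suc binomial_Suc_Suc)
next
  case False
  then show ?thesis by (cases "i = j") (simp_all add: Abel_matrix_def binomial_eq_0)
qed

text \<open>
  The second matrix is the Abel matrix for \<open>x = 0\<close> and \<open>y = 1\<close> without its row and column \<open>0\<close>.
\<close>

lemma totally_positive_tree:
  "totally_positive (\<lambda>i j. real (i choose j) * real (Suc i) ^ (i - j))"
  using real_cone.tp_submatrix[OF real_cone.tp_Abel_matrix(1)[of 0 1], of Suc Suc]
  by (simp add: totally_positive_def strict_mono_def Abel_matrix_0_1 del: of_nat_Suc)

lemma totally_positive_tree_factorial: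
  "totally_positive (\<lambda>i j. real (i choose j) * real (Suc i) ^ (i - j) * fact (Suc j))"
  using real_cone.tp_scale[OF totally_positive_tree[unfolded totally_positive_def],
      of "\<lambda>_. 1" "\<lambda>j. fact (Suc j)"]
  by (simp add: totally_positive_def del: of_nat_Suc fact_Suc)

lemma Abel_matrix_Suc_0: "Abel_matrix x y (Suc n) 0 = x * (x + of_nat (Suc n) * y) ^ n"
  by (simp add: Abel_matrix_def algebra_simps)

lemma poly_I_eq_Abel: "poly_I n = Abel_matrix [:0, 1:] 1 n 0"
proof (cases n)
  case 0
  then show ?thesis by (simp add: poly_I_def Abel_matrix_def)
next
  case (Suc m)
  have "poly_I (Suc m) = (\<Sum>k = 1..Suc m.
      Polynomial.monom (real (m choose (k - 1)) * real (Suc m) ^ (Suc m - k)) k)"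
    by (simp add: poly_I_def del: of_nat_Suc)
  also have "\<dots> = (\<Sum>k\<le>m. Polynomial.monom (real (m choose k) * real (Suc m) ^ (m - k)) (Suc k))"
    by (rule sum.reindex_bij_witness[where i = Suc and j = "\<lambda>k. k - 1"]) auto
  also have "\<dots> = (\<Sum>k\<le>m. [:0, 1:] * (of_nat (m choose k) * [:0, 1:] ^ k * [:real (Suc m):] ^ (m - k)))"
  proof (rule sum.cong)
    fix k
    have "[:0, 1:] * (of_nat (m choose k) * [:0, 1:] ^ k * [:real (Suc m):] ^ (m - k)) =
        smult (real (m choose k) * real (Suc m) ^ (m - k)) ([:0, 1:] ^ Suc k)"
      by (simp add: of_nat_poly poly_const_pow mult_ac del: of_nat_Suc)
    then show "Polynomial.monom (real (m choose k) * real (Suc m) ^ (m - k)) (Suc k) =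
        [:0, 1:] * (of_nat (m choose k) * [:0, 1:] ^ k * [:real (Suc m):] ^ (m - k))"
      by (simp only: monom_altdef)
  qed simp
  also have "\<dots> = [:0, 1:] * ([:0, 1:] + [:real (Suc m):]) ^ m"
    by (simp only: sum_distrib_left[symmetric] binomial_ring)
  also have "\<dots> = Abel_matrix [:0, 1:] 1 (Suc m) 0"
    unfolding Abel_matrix_Suc_0 by (simp only: of_nat_poly mult_1_right)
  finally show ?thesis using Suc by simp
qed

lemma nonneg_coeffs_X: "nonneg_coeffs [:0, 1:]"
  by (auto simp: nonneg_coeffs_def coeff_pCons split: nat.splits)

lemma q_stieltjes_moment_poly_I: "q_stieltjes_moment poly_I"
  unfolding q_stieltjes_moment_def poly_I_eq_Abel
  by (rule poly_cone.tp_Abel_matrix) (rule nonneg_coeffs_X poly_cone.one)+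

lemma q_stieltjes_moment_forests:
  "q_stieltjes_moment (\<lambda>i. [:1, real (Suc i):] ^ i)"
proof -
  have "Abel_matrix 1 [:0, 1:] (Suc i) 0 = [:1, real (Suc i):] ^ i" for i
    unfolding Abel_matrix_Suc_0 by (simp only: of_nat_poly) (simp add: one_pCons)
  moreover have "poly_cone.tp (\<lambda>i j. Abel_matrix 1 [:0, 1:] (Suc i + j) 0)"
    by (rule poly_cone.tp_submatrix[OF poly_cone.tp_Abel_matrix(2), of _ _ Suc "\<lambda>j. j"])
      (auto simp: nonneg_coeffs_X poly_cone.one strict_mono_def)
  ultimately show ?thesis unfolding q_stieltjes_moment_def by simp
qed

text \<open>
  Write \<open>H r m\<close> for the Hankel minor of size \<open>r\<close> that starts at \<open>\<alpha> m\<close>.  The Desnanot-Jacobi identity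
  gives \<open>H 2 m H 2 (m+2) - H 2 (m+1)^2 = \<alpha> (m+2) H 3 m\<close> and the analogous identity one size up.
  Hence the first three iterates of the operator are polynomials with nonnegative coefficients
  in these minors.
\<close>

lemma q_log_convex_if_q_stieltjes_moment:
  assumes "q_stieltjes_moment \<alpha>"
  shows "q_log_convex 3 \<alpha>"
proof -
  define H where "H r m = matrix_minor (\<lambda>i j. \<alpha> (i + j)) r (\<lambda>i. m + i) (\<lambda>j. j)" for r m
  have H_nonneg: "nonneg_coeffs (H r m)" for r m
    unfolding H_def
    by (rule poly_cone.tpD[OF assms[unfolded q_stieltjes_moment_def]]) (auto simp: strict_mono_on_def)
  have H_Suc: "H (Suc 0) m = \<alpha> m" for m
    by (simp add: H_def matrix_minor_expand matrix_minor_0)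
  have H2: "H 2 m = \<alpha> m * \<alpha> (m + 2) - (\<alpha> (m + 1))\<^sup>2" for m
    by (simp add: H_def matrix_minor_expand matrix_minor_0 numeral_eq_Suc)
  have H3: "H 3 m = \<alpha> m * (\<alpha> (m + 2) * \<alpha> (m + 4) - (\<alpha> (m + 3))\<^sup>2)
      - \<alpha> (m + 1) * (\<alpha> (m + 1) * \<alpha> (m + 4) - \<alpha> (m + 2) * \<alpha> (m + 3))
      + \<alpha> (m + 2) * (\<alpha> (m + 1) * \<alpha> (m + 3) - (\<alpha> (m + 2))\<^sup>2)" for m
    by (simp add: H_def matrix_minor_expand matrix_minor_0 numeral_eq_Suc algebra_simps)
  have Desnanot3: "H 2 m * H 2 (m + 2) - (H 2 (m + 1))\<^sup>2 = \<alpha> (m + 2) * H 3 m" for m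
    unfolding H2 H3 by (simp add: numeral_eq_Suc algebra_simps)
  have Desnanot4: "H 3 m * H 3 (m + 2) - (H 3 (m + 1))\<^sup>2 = H 2 (m + 2) * H 4 m" for m
    unfolding H2 H3
    by (simp add: H_def matrix_minor_expand matrix_minor_0 numeral_eq_Suc algebra_simps)
  let ?L = log_convex_op
  have L1: "?L \<alpha> (Suc i) = H 2 i" for i
    by (simp add: log_convex_op_def H2)
  have L2: "?L (?L \<alpha>) (Suc (Suc i)) = \<alpha> (i + 2) * H 3 i" for i
    using Desnanot3[of i] by (simp add: log_convex_op_def[of "?L \<alpha>"] L1)
  have L3: "?L (?L (?L \<alpha>)) (Suc (Suc (Suc i))) =
      H 2 (i + 2) * (\<alpha> (i + 2) * \<alpha> (i + 4) * H 4 i + (H 3 (i + 1))\<^sup>2)" for i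
  proof -
    have "?L (?L (?L \<alpha>)) (Suc (Suc (Suc i))) =
        \<alpha> (i + 2) * \<alpha> (i + 4) * (H 3 i * H 3 (i + 2)) - (\<alpha> (i + 3))\<^sup>2 * (H 3 (i + 1))\<^sup>2"
      by (simp add: log_convex_op_def[of "?L (?L \<alpha>)"] L2 numeral_eq_Suc algebra_simps)
    also have "H 3 i * H 3 (i + 2) = H 2 (i + 2) * H 4 i + (H 3 (i + 1))\<^sup>2"
      using Desnanot4[of i] by (simp add: algebra_simps)
    moreover have h: "H 2 (i + 2) = \<alpha> (i + 2) * \<alpha> (i + 4) - (\<alpha> (i + 3))\<^sup>2"
      using H2[of "i + 2"] by (simp add: numeral_eq_Suc)
    ultimately show ?thesis unfolding h by (simp only: algebra_simps)
  qed
  have "nonneg_coeffs ((?L ^^ m) \<alpha> i)" if m: "m \<in> {1..3}" and im: "i \<ge> m" for m i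
  proof -
    have \<alpha>: "nonneg_coeffs (\<alpha> j)" for j using H_nonneg[of "Suc 0" j] by (simp add: H_Suc)
    obtain j where i: "i = m + j" using im le_Suc_ex by blast
    consider "m = 1" | "m = 2" | "m = 3" using m by fastforce
    then show ?thesis
    proof cases
      case 1
      then show ?thesis by (simp add: i L1 H_nonneg)
    next
      case 2
      then show ?thesis by (simp add: i numeral_eq_Suc L2 H_nonneg poly_cone.mult \<alpha>)
    next
      case 3
      then show ?thesis
        unfolding i by (simp add: numeral_3_eq_3 L3)
          (intro poly_cone.mult poly_cone.add H_nonneg \<alpha>; simp add: power2_eq_square poly_cone.mult H_nonneg)
    qed
  qed
  then show ?thesis unfolding q_log_convex_def by blast
qed

section \<open>Closure properties of Stieltjes moment sequences\<close>

text \<open>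
  It suffices to find a nonnegative random variable with the given moments on an arbitrary measure
  space; its distribution is the measure on the half line.
\<close>

lemma stieltjes_momentI:
  assumes X: "X \<in> borel_measurable M" "\<And>x. x \<in> space M \<Longrightarrow> 0 \<le> X x"
    and a: "\<And>k. 0 \<le> a k" "\<And>k. (\<integral>\<^sup>+x. ennreal (X x ^ k) \<partial>M) = ennreal (a k)"
  shows "stieltjes_moment a"
proof -
  let ?R = "restrict_space borel {0::real..}"
  have X': "X \<in> M \<rightarrow>\<^sub>M ?R"
    using X by (intro measurable_restrict_space2) auto
  have "has_bochner_integral (distr M ?R X) (\<lambda>x. x ^ k) (a k)" for k
  proof (rule has_bochner_integral_nn_integral)
    show meas: "(\<lambda>x. x ^ k) \<in> borel_measurable (distr M ?R X)"
      by (simp add: measurable_restrict_space1)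
    show "AE x in distr M ?R X. 0 \<le> x ^ k"
      by (rule AE_I2) (auto simp: space_restrict_space)
    show "(\<integral>\<^sup>+x. ennreal (x ^ k) \<partial>distr M ?R X) = ennreal (a k)"
      using meas by (subst nn_integral_distr[OF X']) (simp_all add: a)
  qed (rule a)
  then show ?thesis
    unfolding stieltjes_moment_def by (intro exI[of _ "distr M ?R X"]) simp
qed

lemma stieltjes_momentE:
  assumes "stieltjes_moment a"
  obtains M :: "real measure" where "finite_measure M" "space M = {0..}"
    "(\<lambda>x. x) \<in> borel_measurable M" "\<And>k. integrable M (\<lambda>x. x ^ k)"
    "\<And>k. (\<integral>x. x ^ k \<partial>M) = a k" "\<And>k. (\<integral>\<^sup>+x. ennreal (x ^ k) \<partial>M) = ennreal (a k)"
proof -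
  obtain M :: "real measure" where sets: "sets M = sets (restrict_space borel {0..})"
    and int: "\<And>k. has_bochner_integral M (\<lambda>x. x ^ k) (a k)"
    using assms unfolding stieltjes_moment_def by blast
  have space: "space M = {0..}"
    using sets_eq_imp_space_eq[OF sets] by (simp add: space_restrict_space)
  have meas: "(\<lambda>x. x) \<in> borel_measurable M"
    unfolding measurable_cong_sets[OF sets refl] by (rule measurable_restrict_space1) simp
  have nn: "(\<integral>\<^sup>+x. ennreal (x ^ k) \<partial>M) = ennreal (a k)" for k
    using int[of k] by (subst nn_integral_eq_integral)
      (auto simp: has_bochner_integral_iff space)
  have "emeasure M (space M) \<noteq> \<infinity>"
    using nn[of 0] by (simp add: nn_integral_const)
  then have "finite_measure M" by (rule finite_measureI)
  then show thesis using that space meas nn int by (auto simp: has_bochner_integral_iff)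
qed

lemma stieltjes_moment_nonneg:
  assumes "stieltjes_moment a"
  shows "0 \<le> a k"
proof -
  obtain M :: "real measure" where M: "space M = {0..}" "\<And>k. (\<integral>x. x ^ k \<partial>M) = a k"
    using stieltjes_momentE[OF assms] by metis
  have "0 \<le> (\<integral>x. x ^ k \<partial>M)" by (rule Bochner_Integration.integral_nonneg) (simp add: M)
  then show ?thesis by (simp add: M)
qed

lemma stieltjes_moment_geometric:
  assumes "0 \<le> w" "0 \<le> c"
  shows "stieltjes_moment (\<lambda>k. w * c ^ k)"
  by (rule stieltjes_momentI[where M = "point_measure (UNIV :: unit set) (\<lambda>_. ennreal w)" and X = "\<lambda>_. c"])
    (use assms in \<open>simp_all add: emeasure_point_measure_finite space_point_measure UNIV_unit ennreal_mult' mult.commute\<close>)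

text \<open>
  On the product of the two measures, integrate powers of the product of the coordinates.
\<close>

lemma stieltjes_moment_mult:
  assumes "stieltjes_moment a" "stieltjes_moment b"
  shows "stieltjes_moment (\<lambda>k. a k * b k)"
proof -
  obtain M :: "real measure" where M: "finite_measure M" "space M = {0..}"
    "(\<lambda>x. x) \<in> borel_measurable M" "\<And>k. (\<integral>\<^sup>+x. ennreal (x ^ k) \<partial>M) = ennreal (a k)"
    using stieltjes_momentE[OF assms(1)] by metis
  obtain N :: "real measure" where N: "finite_measure N" "space N = {0..}"
    "(\<lambda>x. x) \<in> borel_measurable N" "\<And>k. (\<integral>\<^sup>+x. ennreal (x ^ k) \<partial>N) = ennreal (b k)"
    using stieltjes_momentE[OF assms(2)] by metis
  interpret N: finite_measure N by (rule N)
  note [measurable] = M(3) N(3)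
  show ?thesis
  proof (rule stieltjes_momentI[where M = "M \<Otimes>\<^sub>M N" and X = "\<lambda>z. fst z * snd z"])
    show "(\<integral>\<^sup>+z. ennreal ((fst z * snd z) ^ k) \<partial>(M \<Otimes>\<^sub>M N)) = ennreal (a k * b k)" for k
    proof -
      have "(\<integral>\<^sup>+z. ennreal ((fst z * snd z) ^ k) \<partial>(M \<Otimes>\<^sub>M N)) =
          (\<integral>\<^sup>+x. \<integral>\<^sup>+y. ennreal ((x * y) ^ k) \<partial>N \<partial>M)"
        by (subst N.nn_integral_fst[symmetric]) simp_all
      also have "\<dots> = (\<integral>\<^sup>+x. ennreal (x ^ k) * ennreal (b k) \<partial>M)"
      proof (rule nn_integral_cong)
        fix x assume "x \<in> space M"
        then have "(\<integral>\<^sup>+y. ennreal ((x * y) ^ k) \<partial>N) = (\<integral>\<^sup>+y. ennreal (x ^ k) * ennreal (y ^ k) \<partial>N)"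
          by (intro nn_integral_cong) (simp add: M N power_mult_distrib ennreal_mult')
        also have "\<dots> = ennreal (x ^ k) * ennreal (b k)"
          by (simp add: nn_integral_cmult N)
        finally show "(\<integral>\<^sup>+y. ennreal ((x * y) ^ k) \<partial>N) = ennreal (x ^ k) * ennreal (b k)" .
      qed
      also have "\<dots> = ennreal (a k) * ennreal (b k)"
        by (simp add: nn_integral_multc M)
      finally show ?thesis
        by (simp add: ennreal_mult' stieltjes_moment_nonneg[OF assms(1)])
    qed
  qed (auto simp: space_pair_measure M N stieltjes_moment_nonneg[OF assms(1)] stieltjes_moment_nonneg[OF assms(2)])
qed

lemma stieltjes_moment_scale:
  "stieltjes_moment a \<Longrightarrow> 0 \<le> w \<Longrightarrow> stieltjes_moment (\<lambda>k. w * a k)"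
  using stieltjes_moment_mult[OF stieltjes_moment_geometric[of w 1]] by simp

lemma stieltjes_moment_zero: "stieltjes_moment (\<lambda>k. 0)"
  using stieltjes_moment_geometric[of 0 0] by simp

lemma stieltjes_moment_Suc:
  assumes "stieltjes_moment a"
  shows "stieltjes_moment (\<lambda>k. a (Suc k))"
proof -
  obtain M :: "real measure" where M: "space M = {0..}"
    "(\<lambda>x. x) \<in> borel_measurable M" "\<And>k. (\<integral>\<^sup>+x. ennreal (x ^ k) \<partial>M) = ennreal (a k)"
    using stieltjes_momentE[OF assms] by metis
  note [measurable] = M(2)
  show ?thesis
  proof (rule stieltjes_momentI[where M = "density M (\<lambda>x. ennreal x)" and X = "\<lambda>x. x"])
    show "(\<integral>\<^sup>+x. ennreal (x ^ k) \<partial>density M (\<lambda>x. ennreal x)) = ennreal (a (Suc k))" for k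
    proof -
      have "(\<integral>\<^sup>+x. ennreal (x ^ k) \<partial>density M (\<lambda>x. ennreal x)) = (\<integral>\<^sup>+x. ennreal (x ^ Suc k) \<partial>M)"
        by (subst nn_integral_density) (auto simp: M ennreal_mult' intro!: nn_integral_cong)
      then show ?thesis by (simp add: M(3) del: power_Suc)
    qed
  qed (simp_all add: M stieltjes_moment_nonneg[OF assms])
qed

text \<open>
  Integrate \<open>(x^k - t)^2\<close>.
\<close>

lemma stieltjes_moment_quadratic:
  assumes "stieltjes_moment a"
  shows "0 \<le> a (2 * k) - 2 * t * a k + t\<^sup>2 * a 0"
proof -
  obtain M :: "real measure" where int: "\<And>k. integrable M (\<lambda>x. x ^ k)" and M: "\<And>k. (\<integral>x. x ^ k \<partial>M) = a k"
    using stieltjes_momentE[OF assms] by metis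
  have "(\<integral>x. (x ^ k - t)\<^sup>2 \<partial>M) = (\<integral>x. x ^ (2 * k) - 2 * t * x ^ k + t\<^sup>2 * x ^ 0 \<partial>M)"
    by (rule Bochner_Integration.integral_cong)
      (simp_all add: power2_diff power_even_eq)
  also have "\<dots> = a (2 * k) - 2 * t * a k + t\<^sup>2 * a 0"
  proof (rule has_bochner_integral_integral_eq)
    have moment: "has_bochner_integral M (\<lambda>x. x ^ k) (a k)" for k
      by (simp add: has_bochner_integral_iff int M)
    show "has_bochner_integral M (\<lambda>x. x ^ (2 * k) - 2 * t * x ^ k + t\<^sup>2 * x ^ 0)
        (a (2 * k) - 2 * t * a k + t\<^sup>2 * a 0)"
      by (intro has_bochner_integral_add has_bochner_integral_diff has_bochner_integral_mult_right moment)
  qed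
  finally have "a (2 * k) - 2 * t * a k + t\<^sup>2 * a 0 = (\<integral>x. (x ^ k - t)\<^sup>2 \<partial>M)" ..
  also have "\<dots> \<ge> 0" by (rule Bochner_Integration.integral_nonneg) simp
  finally show ?thesis .
qed

lemma nonneg_affine_imp_zero:
  fixes A B :: real
  assumes "0 \<le> B" and "\<And>t. 0 \<le> A - 2 * t * B"
  shows "B = 0"
proof (rule ccontr)
  assume "B \<noteq> 0"
  then have "A - 2 * ((A + 1) / (2 * B)) * B = - 1" by (simp add: field_simps)
  then show False using assms(2)[of "(A + 1) / (2 * B)"] by simp
qed

lemma stieltjes_moment_eq_zero:
  assumes "stieltjes_moment a" "a 0 = 0"
  shows "a k = 0"
  using nonneg_affine_imp_zero[of "a k" "a (2 * k)"] stieltjes_moment_nonneg[OF assms(1), of k]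
    stieltjes_moment_quadratic[OF assms(1), of k] assms(2) by simp

text \<open>
  A sum of measures is realised as a mixture: on the product of both spaces with a two-point space,
  the point selects the coordinate.  The weights cancel the total mass of the unused coordinate;
  if one total mass is \<open>0\<close>, the corresponding sequence vanishes.
\<close>

lemma stieltjes_moment_add:
  assumes "stieltjes_moment a" "stieltjes_moment b"
  shows "stieltjes_moment (\<lambda>k. a k + b k)"
proof (cases "a 0 = 0 \<or> b 0 = 0")
  case True
  then show ?thesis
  proof
    assume "a 0 = 0"
    then show ?thesis using assms by (simp add: stieltjes_moment_eq_zero[OF assms(1)])
  next
    assume "b 0 = 0"
    then show ?thesis using assms by (simp add: stieltjes_moment_eq_zero[OF assms(2)])
  qed
next
  case False
  note nonneg = stieltjes_moment_nonneg[OF assms(1)] stieltjes_moment_nonneg[OF assms(2)]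
  have pos: "a 0 > 0" "b 0 > 0" using False nonneg(1)[of 0] nonneg(2)[of 0] by auto
  obtain M :: "real measure" where M: "finite_measure M" "space M = {0..}"
    "(\<lambda>x. x) \<in> borel_measurable M" "\<And>k. (\<integral>\<^sup>+x. ennreal (x ^ k) \<partial>M) = ennreal (a k)"
    using stieltjes_momentE[OF assms(1)] by metis
  obtain N :: "real measure" where N: "finite_measure N" "space N = {0..}"
    "(\<lambda>x. x) \<in> borel_measurable N" "\<And>k. (\<integral>\<^sup>+x. ennreal (x ^ k) \<partial>N) = ennreal (b k)"
    using stieltjes_momentE[OF assms(2)] by metis
  interpret M: finite_measure M by (rule M)
  interpret N: finite_measure N by (rule N)
  interpret MN: pair_sigma_finite M N ..
  note [measurable] = M(3) N(3)
  \<comment> \<open>\<open>True\<close> selects the coordinate in \<open>M\<close>, hence the mass \<open>b 0\<close> of \<open>N\<close> is divided out, and vice versa.\<close>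
  let ?D = "point_measure (UNIV :: bool set) (\<lambda>c. ennreal (if c then 1 / b 0 else 1 / a 0))"
  have total: "emeasure M (space M) = ennreal (a 0)" "emeasure N (space N) = ennreal (b 0)"
    using M(4)[of 0] N(4)[of 0] by simp_all
  let ?X = "\<lambda>z. if fst z then fst (snd z) else snd (snd z) :: real"
  have "fst \<in> measurable (?D \<Otimes>\<^sub>M (M \<Otimes>\<^sub>M N)) (count_space UNIV)"
    by (rule measurable_compose[OF measurable_fst]) (simp add: measurable_point_measure_eq1)
  then have meas [measurable]: "?X \<in> borel_measurable (?D \<Otimes>\<^sub>M (M \<Otimes>\<^sub>M N))"
    by measurable
  show ?thesis
  proof (rule stieltjes_momentI[where M = "?D \<Otimes>\<^sub>M (M \<Otimes>\<^sub>M N)" and X = ?X])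
    show "?X \<in> borel_measurable (?D \<Otimes>\<^sub>M (M \<Otimes>\<^sub>M N))" by (rule meas)
    fix k
    have fst: "(\<integral>\<^sup>+z. ennreal (fst z ^ k) \<partial>(M \<Otimes>\<^sub>M N)) = ennreal (a k * b 0)"
      by (subst N.nn_integral_fst[symmetric])
        (simp_all add: total nn_integral_multc M(4) ennreal_mult' nonneg)
    have snd: "(\<integral>\<^sup>+z. ennreal (snd z ^ k) \<partial>(M \<Otimes>\<^sub>M N)) = ennreal (a 0 * b k)"
      by (subst N.nn_integral_fst[symmetric])
        (simp_all add: total N(4) ennreal_mult' nonneg mult.commute)
    have "(\<integral>\<^sup>+z. ennreal (?X z ^ k) \<partial>(?D \<Otimes>\<^sub>M (M \<Otimes>\<^sub>M N))) =
        (\<integral>\<^sup>+c. \<integral>\<^sup>+z. ennreal (?X (c, z) ^ k) \<partial>(M \<Otimes>\<^sub>M N) \<partial>?D)"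
      by (rule MN.P.nn_integral_fst[symmetric]) measurable
    also have "\<dots> = ennreal (1 / b 0) * ennreal (a k * b 0) + ennreal (1 / a 0) * ennreal (a 0 * b k)"
      by (simp add: nn_integral_point_measure_finite UNIV_bool fst snd)
    also have "\<dots> = ennreal (1 / b 0 * (a k * b 0) + 1 / a 0 * (a 0 * b k))"
      using pos nonneg by (subst (1 2) ennreal_mult'[symmetric]) (simp_all add: ennreal_plus)
    also have "\<dots> = ennreal (a k + b k)" using pos by simp
    finally show "(\<integral>\<^sup>+z. ennreal (?X z ^ k) \<partial>(?D \<Otimes>\<^sub>M (M \<Otimes>\<^sub>M N))) = ennreal (a k + b k)" .
  qed (auto simp: space_pair_measure M N nonneg add_nonneg_nonneg)
qed

lemma stieltjes_moment_sum:
  "(\<And>i. i \<in> I \<Longrightarrow> stieltjes_moment (a i)) \<Longrightarrow> stieltjes_moment (\<lambda>k. \<Sum>i\<in>I. a i k)"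
  by (induction I rule: infinite_finite_induct)
    (simp_all add: stieltjes_moment_zero stieltjes_moment_add)

lemma stieltjes_moment_prod:
  "(\<And>i. i \<in> I \<Longrightarrow> stieltjes_moment (a i)) \<Longrightarrow> stieltjes_moment (\<lambda>k. \<Prod>i\<in>I. a i k)"
  using stieltjes_moment_geometric[of 1 1]
  by (induction I rule: infinite_finite_induct) (simp_all add: stieltjes_moment_mult)

lemma real_distribution_of_stieltjes_moment:
  assumes "stieltjes_moment a" "a 0 = 1"
  obtains \<mu> where "real_distribution \<mu>" "AE x in \<mu>. 0 \<le> x"
    "\<And>k. has_bochner_integral \<mu> (\<lambda>x. x ^ k) (a k)"
proof -
  obtain M :: "real measure" where M: "finite_measure M" "space M = {0..}"
    "(\<lambda>x. x) \<in> borel_measurable M" "\<And>k. integrable M (\<lambda>x. x ^ k)"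
    "\<And>k. (\<integral>x. x ^ k \<partial>M) = a k" "\<And>k. (\<integral>\<^sup>+x. ennreal (x ^ k) \<partial>M) = ennreal (a k)"
    using stieltjes_momentE[OF assms(1)] by metis
  note [measurable] = M(3)
  have "emeasure M (space M) = 1" using M(6)[of 0] assms(2) by simp
  then interpret prob_space M by (rule prob_spaceI)
  let ?\<mu> = "distr M borel (\<lambda>x. x)"
  show thesis
  proof (rule that)
    show "real_distribution ?\<mu>" by (rule real_distribution_distr) simp
    show "AE x in ?\<mu>. 0 \<le> x"
      by (subst AE_distr_iff) (auto intro!: AE_I2 simp: M(2))
    show "has_bochner_integral ?\<mu> (\<lambda>x. x ^ k) (a k)" for k
      using M(4)[of k] M(5)[of k]
      by (simp add: has_bochner_integral_iff integrable_distr_eq integral_distr)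
  qed
qed

text \<open>
  Markov's inequality bounds the tails uniformly.
\<close>

lemma tight_of_bounded_means:
  assumes "\<And>m. real_distribution (\<mu> m)" "\<And>m. AE x in \<mu> m. 0 \<le> x"
    and "\<And>m. has_bochner_integral (\<mu> m) (\<lambda>x. x) (b m)" "\<And>m. b m \<le> B"
  shows "tight \<mu>"
  unfolding tight_def
proof (intro conjI allI impI)
  fix \<epsilon> :: real assume \<epsilon>: "0 < \<epsilon>"
  \<comment> \<open>The cutoff is large enough for \<open>B / c < \<epsilon>\<close>.\<close>
  define c where "c = max 0 B / \<epsilon> + 1"
  have c: "c > 0" using \<epsilon> by (simp add: c_def add_nonneg_pos)
  have "B < c * \<epsilon>"
    using \<epsilon> by (simp add: c_def distrib_right)
  have "1 - \<epsilon> < measure (\<mu> m) {-1<..c}" for m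
  proof -
    interpret real_distribution "\<mu> m" by (rule assms)
    have "measure (\<mu> m) {x \<in> space (\<mu> m). c \<le> x} \<le> (\<integral>x. x \<partial>\<mu> m) / c"
      by (rule integral_Markov_inequality_measure[of _ _ "{}"])
        (use assms(2,3)[of m] c in \<open>auto simp: has_bochner_integral_iff\<close>)
    also have "\<dots> \<le> B / c"
      using assms(3,4)[of m] c by (simp add: has_bochner_integral_iff divide_right_mono)
    also have "\<dots> < \<epsilon>"
      using \<open>B < c * \<epsilon>\<close> c by (simp add: divide_less_eq mult.commute)
    finally have "measure (\<mu> m) {x \<in> space (\<mu> m). c \<le> x} < \<epsilon>" .
    moreover have "measure (\<mu> m) {x \<in> space (\<mu> m). c \<le> x} =
        1 - measure (\<mu> m) (space (\<mu> m) - {x \<in> space (\<mu> m). c \<le> x})"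
      by (subst prob_compl) auto
    moreover have "measure (\<mu> m) (space (\<mu> m) - {x \<in> space (\<mu> m). c \<le> x}) \<le> measure (\<mu> m) {-1<..c}"
      by (rule finite_measure_mono_AE) (use assms(2)[of m] in \<open>auto elim!: eventually_mono\<close>)
    ultimately show ?thesis by linarith
  qed
  then show "\<exists>a b. a < b \<and> (\<forall>m. 1 - \<epsilon> < measure (\<mu> m) {a<..b})"
    using c by (intro exI[of _ "-1"] exI[of _ c]) auto
qed (rule assms)

text \<open>
  The truncation is bounded and continuous, so weak convergence controls it.  For the lower bound,
  \<open>u - u^2 / K \<le> min u K\<close> for every \<open>u \<ge> 0\<close>, applied to \<open>u = x^k\<close>.
\<close>

lemma truncated_moment_bounds:
  assumes "real_distribution \<mu>" "AE x in \<mu>. 0 \<le> x"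
    and moment: "\<And>k. has_bochner_integral \<mu> (\<lambda>x. x ^ k) (a k)" and K: "0 < K"
  shows "(\<integral>x. min (max 0 x ^ k) K \<partial>\<mu>) \<le> a k" "a k - a (2 * k) / K \<le> (\<integral>x. min (max 0 x ^ k) K \<partial>\<mu>)"
proof -
  interpret real_distribution \<mu> by (rule assms)
  have int: "integrable \<mu> (\<lambda>x. min (max 0 x ^ k) K)"
    by (rule integrable_const_bound[where B = K]) (use K in auto)
  show "(\<integral>x. min (max 0 x ^ k) K \<partial>\<mu>) \<le> a k"
    unfolding has_bochner_integral_integral_eq[OF moment[of k], symmetric]
  proof (rule integral_mono_AE)
    show "AE x in \<mu>. min (max 0 x ^ k) K \<le> x ^ k"
      using assms(2) by eventually_elim (simp add: max_def)
  qed (use int moment in \<open>auto simp: has_bochner_integral_iff\<close>)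
  have lower: "has_bochner_integral \<mu> (\<lambda>x. x ^ k - x ^ (2 * k) / K) (a k - a (2 * k) / K)"
    by (intro has_bochner_integral_diff has_bochner_integral_divide_zero moment)
  show "a k - a (2 * k) / K \<le> (\<integral>x. min (max 0 x ^ k) K \<partial>\<mu>)"
    unfolding has_bochner_integral_integral_eq[OF lower, symmetric]
  proof (rule integral_mono_AE)
    show "AE x in \<mu>. x ^ k - x ^ (2 * k) / K \<le> min (max 0 x ^ k) K"
      using assms(2)
    proof eventually_elim
      case (elim x)
      have sq: "x ^ (2 * k) = x ^ k * x ^ k" by (simp add: mult_2 power_add)
      show ?case
      proof (cases "x ^ k \<le> K")
        case True
        then show ?thesis using elim K by (simp add: max_def sq)
      next
        case False
        then have "x ^ k * K \<le> x ^ k * x ^ k" using K by (intro mult_left_mono) auto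
        then have "x ^ k \<le> x ^ (2 * k) / K" using K by (simp add: sq pos_le_divide_eq)
        then show ?thesis using False elim K by (simp add: max_def)
      qed
    qed
  qed (use int lower in \<open>auto simp: has_bochner_integral_iff\<close>)
qed

text \<open>
  Bounded means make the measures tight, so a subsequence converges weakly.  The moments converge
  with it: truncation at height \<open>K\<close> changes the moment of order \<open>k\<close> by at most the moment of order
  \<open>2 k\<close> divided by \<open>K\<close>, which is small uniformly along the sequence.
\<close>

lemma stieltjes_moment_limit_normalised:
  assumes a: "\<And>m. stieltjes_moment (a m)" and a0: "\<And>m. a m 0 = 1"
    and lim: "\<And>k. (\<lambda>m. a m k) \<longlonglongrightarrow> l k"
  shows "stieltjes_moment l"
proof -
  have "\<exists>\<mu>. real_distribution \<mu> \<and> (AE x in \<mu>. 0 \<le> x) \<and>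
      (\<forall>k. has_bochner_integral \<mu> (\<lambda>x. x ^ k) (a m k))" for m
    using real_distribution_of_stieltjes_moment[OF a a0] by metis
  then obtain \<mu> where \<mu>: "\<And>m. real_distribution (\<mu> m)" "\<And>m. AE x in \<mu> m. 0 \<le> x"
      "\<And>m k. has_bochner_integral (\<mu> m) (\<lambda>x. x ^ k) (a m k)"
    by metis
  obtain B where "\<And>m. a m 1 \<le> B"
    using convergent_imp_Bseq[OF convergentI[OF lim[of 1]]] by (auto simp: Bseq_def abs_le_iff)
  then have "tight \<mu>"
    using \<mu>(3)[of _ 1] by (intro tight_of_bounded_means[OF \<mu>(1,2)]) auto
  then obtain r M where r: "strict_mono r" and M: "real_distribution M"
      and conv: "weak_conv_m (\<mu> \<circ> id \<circ> r) M"
    using tight_imp_convergent_subsubsequence[of \<mu> id] strict_mono_id by blast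
  interpret M: real_distribution M by (rule M)
  have l_nonneg: "0 \<le> l k" for k
    by (rule LIMSEQ_le_const[OF lim]) (auto intro: stieltjes_moment_nonneg[OF a])
  let ?f = "\<lambda>k K x::real. min (max 0 x ^ k) K"
  have f_lim: "(\<lambda>m. \<integral>x. ?f k K x \<partial>\<mu> (r m)) \<longlonglongrightarrow> (\<integral>x. ?f k K x \<partial>M)" if "0 < K" for k K
  proof -
    have "(\<lambda>m. \<integral>x. ?f k K x \<partial>(\<mu> \<circ> id \<circ> r) m) \<longlonglongrightarrow> (\<integral>x. ?f k K x \<partial>M)"
    proof (rule weak_conv_imp_integral_bdd_continuous_conv[OF _ M conv])
      show "isCont (?f k K) x" for x by (intro continuous_intros)
      show "norm (?f k K x) \<le> K" for x using that by simp
    qed (use \<mu>(1) in simp)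
    then show ?thesis by simp
  qed
  have lim_r: "(\<lambda>m. a (r m) k) \<longlonglongrightarrow> l k" for k
    using LIMSEQ_subseq_LIMSEQ[OF lim r] by (simp add: o_def)
  have upper: "(\<integral>x. ?f k K x \<partial>M) \<le> l k" if "0 < K" for k K
    by (rule LIMSEQ_le[OF f_lim[OF that] lim_r]) (use truncated_moment_bounds(1)[OF \<mu> that] in auto)
  have lower: "l k - l (2 * k) / K \<le> (\<integral>x. ?f k K x \<partial>M)" if "0 < K" for k K
    by (rule LIMSEQ_le[OF tendsto_diff[OF lim_r tendsto_divide[OF lim_r tendsto_const]] f_lim[OF that]])
      (use truncated_moment_bounds(2)[OF \<mu> that] that in auto)
  show ?thesis
  proof (rule stieltjes_momentI[where M = M and X = "max 0"])
    fix k
    have "(\<lambda>n. \<integral>x. ?f k (real (Suc n)) x \<partial>M) \<longlonglongrightarrow> l k"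
    proof (rule tendsto_sandwich)
      have "(\<lambda>n. l k - l (2 * k) * inverse (real (Suc n))) \<longlonglongrightarrow> l k - l (2 * k) * 0"
        by (intro tendsto_intros LIMSEQ_inverse_real_of_nat)
      then show "(\<lambda>n. l k - l (2 * k) / real (Suc n)) \<longlonglongrightarrow> l k"
        by (simp add: divide_inverse)
    qed (use upper lower in \<open>auto simp del: of_nat_Suc\<close>)
    then have "(\<lambda>n. ennreal (\<integral>x. ?f k (real (Suc n)) x \<partial>M)) \<longlonglongrightarrow> ennreal (l k)"
      by (rule tendsto_ennrealI)
    moreover have "ennreal (\<integral>x. ?f k (real (Suc n)) x \<partial>M) = (\<integral>\<^sup>+x. ennreal (?f k (real (Suc n)) x) \<partial>M)" for n
      by (rule nn_integral_eq_integral[symmetric])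
        (auto intro!: M.integrable_const_bound[where B = "real (Suc n)"] simp del: of_nat_Suc)
    ultimately have "(\<lambda>n. \<integral>\<^sup>+x. ennreal (?f k (real (Suc n)) x) \<partial>M) \<longlonglongrightarrow> ennreal (l k)"
      by simp
    moreover have "(\<lambda>n. \<integral>\<^sup>+x. ennreal (?f k (real (Suc n)) x) \<partial>M) \<longlonglongrightarrow> (\<integral>\<^sup>+x. ennreal (max 0 x ^ k) \<partial>M)"
    proof (rule nn_integral_LIMSEQ)
      show "incseq (\<lambda>n x. ennreal (?f k (real (Suc n)) x))"
        by (intro incseq_SucI le_funI ennreal_leI min.mono) auto
      show "(\<lambda>n. ennreal (?f k (real (Suc n)) x)) \<longlonglongrightarrow> ennreal (max 0 x ^ k)" for x
      proof (rule tendsto_eventually, rule eventually_sequentiallyI)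
        fix n assume "nat \<lceil>max 0 x ^ k\<rceil> \<le> n"
        then have "max 0 x ^ k \<le> real (Suc n)" by linarith
        then show "ennreal (?f k (real (Suc n)) x) = ennreal (max 0 x ^ k)" by simp
      qed
    qed simp
    ultimately show "(\<integral>\<^sup>+x. ennreal (max 0 x ^ k) \<partial>M) = ennreal (l k)"
      using LIMSEQ_unique by blast
  qed (simp_all add: l_nonneg)
qed

text \<open>
  Normalisation by the total masses reduces this to probability measures, unless the limit of the
  masses is \<open>0\<close>; then the quadratic inequality makes all limits vanish.
\<close>

theorem stieltjes_moment_limit:
  assumes a: "\<And>m. stieltjes_moment (a m)" and lim: "\<And>k. (\<lambda>m. a m k) \<longlonglongrightarrow> l k"
  shows "stieltjes_moment l"
proof (cases "l 0 = 0")
  case True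
  have nonneg: "0 \<le> l k" for k
    by (rule LIMSEQ_le_const[OF lim]) (auto intro: stieltjes_moment_nonneg[OF a])
  have "0 \<le> l (2 * k) - 2 * t * l k" for k t
  proof -
    have "(\<lambda>m. a m (2 * k) - 2 * t * a m k + t\<^sup>2 * a m 0) \<longlonglongrightarrow> l (2 * k) - 2 * t * l k + t\<^sup>2 * l 0"
      by (intro tendsto_intros lim)
    then have "0 \<le> l (2 * k) - 2 * t * l k + t\<^sup>2 * l 0"
      by (rule LIMSEQ_le_const) (auto intro: stieltjes_moment_quadratic[OF a])
    then show ?thesis using True by simp
  qed
  then have "l k = 0" for k using nonneg nonneg_affine_imp_zero by blast
  then have "l = (\<lambda>k. 0)" by auto
  then show ?thesis using stieltjes_moment_zero by simp
next
  case False
  moreover have "0 \<le> l 0"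
    by (rule LIMSEQ_le_const[OF lim]) (auto intro: stieltjes_moment_nonneg[OF a])
  ultimately have l0: "0 < l 0" by simp
  then have "\<forall>\<^sub>F m in sequentially. 0 < a m 0"
    using order_tendstoD(1)[OF lim] by blast
  then obtain m0 where m0: "\<And>m. m \<ge> m0 \<Longrightarrow> 0 < a m 0"
    by (auto simp: eventually_sequentially)
  have "stieltjes_moment (\<lambda>k. 1 / l 0 * l k)"
  proof (rule stieltjes_moment_limit_normalised)
    let ?b = "\<lambda>m k. 1 / a (m + m0) 0 * a (m + m0) k"
    show "stieltjes_moment (?b m)" for m
      using m0[of "m + m0"] by (intro stieltjes_moment_scale a) simp
    show "?b m 0 = 1" for m using m0[of "m + m0"] by simp
    show "(\<lambda>m. ?b m k) \<longlonglongrightarrow> 1 / l 0 * l k" for k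
      using l0 by (intro tendsto_intros LIMSEQ_ignore_initial_segment[OF lim]) simp
  qed
  then show ?thesis using stieltjes_moment_scale[of _ "l 0"] l0 by fastforce
qed

section \<open>Rising factorials as moments\<close>

lemma stieltjes_moment_Gamma:
  assumes "0 < a"
  shows "stieltjes_moment (\<lambda>k. Gamma (a + real k))"
proof (rule stieltjes_momentI[where X = "\<lambda>t. max 0 t" and
      M = "density lborel (\<lambda>t::real. ennreal (if t \<in> {0..} then t powr (a - 1) / exp t else 0))"])
  fix k
  let ?w = "\<lambda>t::real. if t \<in> {0..} then t powr (a - 1) / exp t else 0"
  let ?g = "\<lambda>t::real. if t \<in> {0..} then t powr (a + real k - 1) / exp t else 0"
  have eq: "?w t * max 0 t ^ k = ?g t" for t
  proof (cases "t > 0")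
    case True
    then have "t powr (a + real k - 1) = t powr (a - 1) * t ^ k"
      by (simp add: powr_realpow[symmetric] powr_add[symmetric] algebra_simps)
    then show ?thesis using True by simp
  qed auto
  have "(\<integral>\<^sup>+t. ennreal (max 0 t ^ k) \<partial>density lborel (\<lambda>t. ennreal (?w t))) =
      (\<integral>\<^sup>+t. ennreal (?w t * max 0 t ^ k) \<partial>lborel)"
    by (subst nn_integral_density) (auto simp: ennreal_mult' intro!: nn_integral_cong)
  also have "\<dots> = (\<integral>\<^sup>+t. ennreal (?g t) \<partial>lborel)"
    by (simp only: eq)
  also have "\<dots> = ennreal (Gamma (a + real k))"
  proof (rule nn_integral_has_integral_lborel)
    have "((\<lambda>t. t powr (a + real k - 1) / exp t) has_integral Gamma (a + real k)) {0..}"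
      using assms by (intro Gamma_integral_real) simp
    then show "(?g has_integral Gamma (a + real k)) UNIV"
      by (simp only: has_integral_restrict_UNIV)
  qed auto
  finally show "(\<integral>\<^sup>+t. ennreal (max 0 t ^ k) \<partial>density lborel (\<lambda>t. ennreal (?w t))) = ennreal (Gamma (a + real k))" .
  show "0 \<le> Gamma (a + real k)" using assms by (intro less_imp_le Gamma_real_pos) simp
qed simp_all

lemma stieltjes_moment_Beta:
  assumes "0 < a" "0 < b"
  shows "stieltjes_moment (\<lambda>k. Beta (a + real k) b)"
proof (rule stieltjes_momentI[where X = "\<lambda>t. max 0 t" and
      M = "density lborel (\<lambda>t::real. ennreal (if t \<in> {0..1} then t powr (a - 1) * (1 - t) powr (b - 1) else 0))"])
  fix k
  let ?w = "\<lambda>t::real. if t \<in> {0..1} then t powr (a - 1) * (1 - t) powr (b - 1) else 0"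
  let ?g = "\<lambda>t::real. if t \<in> {0..1} then t powr (a + real k - 1) * (1 - t) powr (b - 1) else 0"
  have eq: "?w t * max 0 t ^ k = ?g t" for t
  proof (cases "t > 0")
    case True
    then have "t powr (a + real k - 1) = t powr (a - 1) * t ^ k"
      by (simp add: powr_realpow[symmetric] powr_add[symmetric] algebra_simps)
    then show ?thesis using True by simp
  qed auto
  have "(\<integral>\<^sup>+t. ennreal (max 0 t ^ k) \<partial>density lborel (\<lambda>t. ennreal (?w t))) =
      (\<integral>\<^sup>+t. ennreal (?w t * max 0 t ^ k) \<partial>lborel)"
    by (subst nn_integral_density) (auto simp: ennreal_mult' intro!: nn_integral_cong)
  also have "\<dots> = (\<integral>\<^sup>+t. ennreal (?g t) \<partial>lborel)"
    by (simp only: eq)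
  also have "\<dots> = ennreal (Beta (a + real k) b)"
  proof (rule nn_integral_has_integral_lborel)
    have "((\<lambda>t. t powr (a + real k - 1) * (1 - t) powr (b - 1)) has_integral Beta (a + real k) b) {0..1}"
      using assms by (intro has_integral_Beta_real) simp_all
    then show "(?g has_integral Beta (a + real k) b) UNIV"
      by (simp only: has_integral_restrict_UNIV)
  qed auto
  finally show "(\<integral>\<^sup>+t. ennreal (max 0 t ^ k) \<partial>density lborel (\<lambda>t. ennreal (?w t))) = ennreal (Beta (a + real k) b)" .
  show "0 \<le> Beta (a + real k) b"
    using assms by (auto simp: Beta_def intro!: divide_nonneg_nonneg mult_nonneg_nonneg less_imp_le[OF Gamma_real_pos])
qed simp_all

lemma pochhammer_eq_Gamma:
  "0 < a \<Longrightarrow> pochhammer a k = Gamma (a + real k) / Gamma a" for a :: real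
  by (rule pochhammer_Gamma) (auto elim!: nonpos_Ints_cases)

lemma stieltjes_moment_pochhammer:
  "0 < a \<Longrightarrow> stieltjes_moment (pochhammer a)"
  for a :: real
proof -
  assume a: "0 < a"
  then have "pochhammer a = (\<lambda>k. 1 / Gamma a * Gamma (a + real k))"
    by (simp add: fun_eq_iff pochhammer_eq_Gamma)
  then show ?thesis
    using stieltjes_moment_scale[OF stieltjes_moment_Gamma[OF a], of "1 / Gamma a"] a by (simp add: less_imp_le)
qed

text \<open>
  These are the moments of the Beta distribution with parameters \<open>a\<close> and \<open>c - a\<close>.
\<close>

lemma stieltjes_moment_pochhammer_ratio:
  assumes "0 < a" "a < c"
  shows "stieltjes_moment (\<lambda>k. pochhammer a k / pochhammer c k)"
proof -
  have pos: "Gamma a > 0" "Gamma c > 0" "Gamma (c - a) > 0" using assms by simp_all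
  then have "Gamma (c - a) \<noteq> 0" by linarith
  have "pochhammer a k / pochhammer c k = Gamma c / (Gamma a * Gamma (c - a)) * Beta (a + real k) (c - a)" for k
    using assms \<open>Gamma (c - a) \<noteq> 0\<close> by (simp add: pochhammer_eq_Gamma Beta_def field_simps)
  moreover have "stieltjes_moment (\<lambda>k. Gamma c / (Gamma a * Gamma (c - a)) * Beta (a + real k) (c - a))"
    using assms pos by (intro stieltjes_moment_scale stieltjes_moment_Beta) (simp_all add: less_imp_le)
  ultimately show ?thesis by simp
qed

text \<open>
  The Gauss multiplication formula: the factors \<open>r, r + 1, ...\<close> are sorted by residue class
  modulo \<open>m\<close>.
\<close>

lemma pochhammer_multiplication:
  fixes r :: real
  assumes "m > 0"
  shows "pochhammer r (m * n) = (real m ^ m) ^ n * (\<Prod>i<m. pochhammer ((r + real i) / real m) n)"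
proof (induction n)
  case (Suc n)
  have "pochhammer (r + real (m * n)) m = (\<Prod>i<m. real m * ((r + real i) / real m + real n))"
    unfolding pochhammer_prod atLeast0LessThan
    by (rule prod.cong) (use assms in \<open>auto simp: field_simps\<close>)
  also have "\<dots> = real m ^ m * (\<Prod>i<m. (r + real i) / real m + real n)"
    by (simp only: prod.distrib prod_constant card_lessThan)
  finally have block: "pochhammer (r + real (m * n)) m = \<dots>" .
  have "pochhammer r (m * Suc n) = pochhammer r (m * n) * pochhammer (r + real (m * n)) m"
    by (simp only: mult_Suc_right add.commute[of m] pochhammer_product')
  then show ?case
    unfolding block Suc by (simp only: pochhammer_Suc prod.distrib power_Suc mult_ac)
qed simp


text \<open>
  By the multiplication formula, both rising factorials split into rising factorials of length
  \<open>n\<close>, with bases \<open>(r + i) / (p + 1)\<close> for \<open>i \<le> p\<close> in the numerator and \<open>(r + i) / p\<close> for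
  \<open>i < p\<close> in the denominator.  Pairing equal \<open>i\<close> gives Beta moments; the
  numerator with \<open>i = p\<close> remains and gives Gamma moments.
\<close>

lemma stieltjes_moment_pochhammer_quotient:
  assumes r: "0 < r" and p: "0 < p"
  shows "stieltjes_moment (\<lambda>n. pochhammer r (Suc p * n) / pochhammer r (p * n))"
proof -
  have "pochhammer r (Suc p * n) / pochhammer r (p * n) =
      1 * (real (Suc p) ^ Suc p / real p ^ p) ^ n *
      ((\<Prod>i<p. pochhammer ((r + real i) / real (Suc p)) n / pochhammer ((r + real i) / real p) n) *
        pochhammer ((r + real p) / real (Suc p)) n)" for n
    unfolding pochhammer_multiplication[OF p] pochhammer_multiplication[OF zero_less_Suc]
    by (simp add: prod_dividef power_divide del: power_Suc of_nat_Suc)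
  moreover have "stieltjes_moment (\<lambda>n. 1 * (real (Suc p) ^ Suc p / real p ^ p) ^ n *
      ((\<Prod>i<p. pochhammer ((r + real i) / real (Suc p)) n / pochhammer ((r + real i) / real p) n) *
        pochhammer ((r + real p) / real (Suc p)) n))"
  proof (rule stieltjes_moment_mult[OF stieltjes_moment_geometric stieltjes_moment_mult
        [OF stieltjes_moment_prod[OF stieltjes_moment_pochhammer_ratio] stieltjes_moment_pochhammer]])
    show "(r + real i) / real (Suc p) < (r + real i) / real p" for i
      using r p by (intro divide_strict_left_mono) auto
  qed (use r p in \<open>auto intro!: divide_pos_pos add_pos_nonneg\<close>)
  ultimately show ?thesis by simp
qed

text \<open>
  The sequence \<open>?a m\<close> is \<open>s/(s+n)\<close> times the product over \<open>i < n\<close> of \<open>s + n + i/(m+1)\<close>.  The factor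
  \<open>s/(s+n)\<close> is itself a quotient of rising factorials.
\<close>

lemma stieltjes_moment_Abel_1:
  assumes s: "0 < s"
  shows "stieltjes_moment (\<lambda>n. s / (s + real n) * (s + real n) ^ n)"
proof (rule stieltjes_moment_limit)
  \<comment> \<open>\<open>m + 1\<close> in place of \<open>m\<close> avoids division by \<open>0\<close>.\<close>
  let ?a = "\<lambda>m n. pochhammer s n / pochhammer (s + 1) n *
     (pochhammer (s * real (Suc m)) (Suc (Suc m) * n) / pochhammer (s * real (Suc m)) (Suc m * n)) *
     (1 * (1 / real (Suc m)) ^ n)"
  show "stieltjes_moment (?a m)" for m
    using s by (intro stieltjes_moment_mult stieltjes_moment_geometric
        stieltjes_moment_pochhammer_ratio stieltjes_moment_pochhammer_quotient) auto
  show "(\<lambda>m. ?a m n) \<longlonglongrightarrow> s / (s + real n) * (s + real n) ^ n" for n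
  proof -
    have factor: "pochhammer s n / pochhammer (s + 1) n = s / (s + real n)"
    proof -
      have "pochhammer s n * (s + real n) = s * pochhammer (s + 1) n"
        using pochhammer_rec[of s n] pochhammer_Suc[of s n] by simp
      moreover have "pochhammer (s + 1) n > 0" using s by (intro pochhammer_pos) simp
      ultimately show ?thesis using s by (simp add: field_simps)
    qed
    have "?a m n = s / (s + real n) * (\<Prod>i<n. s + real n + real i * inverse (real (Suc m)))" for m
    proof -
      let ?r = "s * real (Suc m)"
      have "pochhammer ?r (Suc m * n) > 0" using s by (intro pochhammer_pos) simp
      moreover have "pochhammer ?r (Suc (Suc m) * n) =
          pochhammer ?r (Suc m * n) * pochhammer (?r + real (Suc m * n)) n"
        using pochhammer_product'[of ?r "Suc m * n" n] by (simp add: add.commute)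
      ultimately have "pochhammer ?r (Suc (Suc m) * n) / pochhammer ?r (Suc m * n) =
          pochhammer (?r + real (Suc m * n)) n"
        by simp
      moreover have "pochhammer (?r + real (Suc m * n)) n * (1 / real (Suc m)) ^ n =
          (\<Prod>i<n. (?r + real (Suc m * n) + real i) * (1 / real (Suc m)))"
        by (simp only: pochhammer_prod atLeast0LessThan prod.distrib prod_constant card_lessThan)
      moreover have "(?r + real (Suc m * n) + real i) * (1 / real (Suc m)) =
          s + real n + real i * inverse (real (Suc m))" for i
        unfolding of_nat_mult by (simp add: field_simps del: of_nat_Suc)
      ultimately show ?thesis by (simp only: factor mult.assoc mult_1_left)
    qed
    moreover have "(\<lambda>m. s / (s + real n) * (\<Prod>i<n. s + real n + real i * inverse (real (Suc m))))
        \<longlonglongrightarrow> s / (s + real n) * (\<Prod>i<n. s + real n + real i * 0)"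
      by (intro tendsto_intros LIMSEQ_inverse_real_of_nat)
    ultimately show ?thesis by simp
  qed
qed

text \<open>
  Homogeneity in \<open>(s, t)\<close> reduces to \<open>t = 1\<close>; if \<open>s\<close> or \<open>t\<close> vanishes, the sequence is geometric.
\<close>

lemma stieltjes_moment_Abel:
  assumes "0 \<le> s" "0 \<le> t"
  shows "stieltjes_moment (\<lambda>n. if n = 0 then 1 else s * (s + real n * t) ^ (n - 1))"
    (is "stieltjes_moment ?a")
proof (cases "s = 0 \<or> t = 0")
  case True
  have "?a n = 1 * s ^ n" for n
    using True by (cases n) auto
  then show ?thesis using stieltjes_moment_geometric[of 1 s] assms by simp
next
  case False
  then have pos: "0 < s" "0 < t" using assms by auto
  have "?a n = 1 * t ^ n * (s / t / (s / t + real n) * (s / t + real n) ^ n)" for n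
  proof (cases n)
    case (Suc m)
    have "s / t + real n > 0" using pos by (simp add: add_pos_nonneg)
    then have "1 * t ^ n * (s / t / (s / t + real n) * (s / t + real n) ^ n) =
        s * (t * (s / t + real n)) ^ m"
      using pos by (simp add: Suc power_mult_distrib del: of_nat_Suc)
    also have "t * (s / t + real n) = s + real n * t"
      using pos by (simp add: distrib_left mult.commute)
    finally show ?thesis by (simp add: Suc del: of_nat_Suc)
  qed (use pos in simp)
  moreover have "stieltjes_moment (\<lambda>n. 1 * t ^ n * (s / t / (s / t + real n) * (s / t + real n) ^ n))"
    using pos by (intro stieltjes_moment_mult stieltjes_moment_geometric stieltjes_moment_Abel_1) auto
  ultimately show ?thesis by simp
qed

text \<open>
  For \<open>s > 0\<close> this is the shifted Abel sequence divided by \<open>s\<close>; a limit covers \<open>s = 0\<close>.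
\<close>

lemma stieltjes_moment_Abel_Suc:
  assumes "0 \<le> s" "0 \<le> t"
  shows "stieltjes_moment (\<lambda>n. (s + real (n + 1) * t) ^ n)"
proof (rule stieltjes_moment_limit)
  let ?s = "\<lambda>m. s + inverse (real (Suc m))"
  show "stieltjes_moment (\<lambda>n. (?s m + real (n + 1) * t) ^ n)" for m
  proof -
    have "?s m > 0" using assms by (intro add_nonneg_pos) auto
    then show ?thesis
      using stieltjes_moment_scale[OF stieltjes_moment_Suc[OF stieltjes_moment_Abel[of "?s m" t]], of "1 / ?s m"]
        assms(2) by (simp add: add.commute del: of_nat_Suc)
  qed
  have "(\<lambda>m. (?s m + real (n + 1) * t) ^ n) \<longlonglongrightarrow> (s + 0 + real (n + 1) * t) ^ n" for n
    by (intro tendsto_intros LIMSEQ_inverse_real_of_nat)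
  then show "(\<lambda>m. (?s m + real (n + 1) * t) ^ n) \<longlonglongrightarrow> (s + real (n + 1) * t) ^ n" for n
    by simp
qed

section \<open>Convolutions that preserve the moment property\<close>

text \<open>
  Approximate the identity on the half line by simple functions from below.  The moments of their
  distributions, which have finitely many atoms, converge by dominated convergence.
\<close>

lemma stieltjes_moment_discrete_approximation:
  assumes "stieltjes_moment x"
  shows "\<exists>(C :: nat \<Rightarrow> real set) w. (\<forall>m. finite (C m)) \<and> (\<forall>m. \<forall>c\<in>C m. 0 \<le> c) \<and>
    (\<forall>m c. 0 \<le> w m c) \<and> (\<forall>k. (\<lambda>m. \<Sum>c\<in>C m. w m c * c ^ k) \<longlonglongrightarrow> x k)"
proof -
  obtain M :: "real measure" where M: "finite_measure M" "space M = {0..}"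
    "(\<lambda>x. x) \<in> borel_measurable M" "\<And>k. integrable M (\<lambda>x. x ^ k)" "\<And>k. (\<integral>x. x ^ k \<partial>M) = x k"
    using stieltjes_momentE[OF assms] by metis
  interpret finite_measure M by (rule M)
  note [measurable] = M(3)
  obtain f where f: "incseq f" "\<And>m. simple_function M (f m)" "\<And>x. bdd_above (range (\<lambda>m. f m x))"
      "\<And>m x. 0 \<le> f m x" "max 0 = (SUP m. f m :: real \<Rightarrow> real)"
    using borel_measurable_implies_simple_function_sequence_real[of "max 0" M] by auto
  have meas [measurable]: "f m \<in> borel_measurable M" for m
    using f(2) by (rule borel_measurable_simple_function)
  have sup: "(SUP m. f m t) = max 0 t" for t
    by (simp add: f(5) image_image)
  have f_lim: "(\<lambda>m. f m t) \<longlonglongrightarrow> max 0 t" for t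
    unfolding sup[symmetric] using f(1,3) by (intro LIMSEQ_incseq_SUP) (auto simp: incseq_def le_fun_def)
  have f_le: "f m t \<le> max 0 t" for m t
    unfolding sup[symmetric] by (rule cSUP_upper[OF UNIV_I f(3)])
  define w where "w m c = measure M {t \<in> space M. f m t = c}" for m c
  have moments: "(\<integral>t. f m t ^ k \<partial>M) = (\<Sum>c\<in>f m ` space M. w m c * c ^ k)" for m k
  proof -
    let ?A = "\<lambda>c. {t \<in> space M. f m t = c}"
    have fin: "finite (f m ` space M)" using f(2) by (simp add: simple_function_def)
    have "(\<integral>t. f m t ^ k \<partial>M) = (\<integral>t. (\<Sum>c\<in>f m ` space M. indicator (?A c) t *\<^sub>R c ^ k) \<partial>M)"
    proof (rule Bochner_Integration.integral_cong)
      fix t assume t: "t \<in> space M"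
      have "(\<Sum>c\<in>f m ` space M. indicator (?A c) t *\<^sub>R c ^ k) =
          (\<Sum>c\<in>f m ` space M. if c = f m t then c ^ k else 0)"
        by (rule sum.cong) (use t in \<open>auto simp: indicator_def\<close>)
      then show "f m t ^ k = (\<Sum>c\<in>f m ` space M. indicator (?A c) t *\<^sub>R c ^ k)"
        using t fin by (simp add: sum.delta)
    qed simp
    also have "\<dots> = (\<Sum>c\<in>f m ` space M. measure M (?A c) *\<^sub>R c ^ k)"
      by (intro has_bochner_integral_integral_eq has_bochner_integral_sum has_bochner_integral_indicator)
        (auto simp: emeasure_finite less_top[symmetric])
    finally show ?thesis by (simp add: w_def)
  qed
  have "(\<lambda>m. \<integral>t. f m t ^ k \<partial>M) \<longlonglongrightarrow> (\<integral>t. t ^ k \<partial>M)" for k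
  proof (rule integral_dominated_convergence)
    show "integrable M (\<lambda>t. t ^ k)" by (rule M(4))
    show "AE t in M. (\<lambda>m. f m t ^ k) \<longlonglongrightarrow> t ^ k"
    proof (rule AE_I2)
      fix t assume "t \<in> space M"
      then have "max 0 t = t" by (simp add: M(2))
      then show "(\<lambda>m. f m t ^ k) \<longlonglongrightarrow> t ^ k" using tendsto_power[OF f_lim[of t]] by simp
    qed
    show "AE t in M. norm (f m t ^ k) \<le> t ^ k" for m
    proof (rule AE_I2)
      fix t assume "t \<in> space M"
      then have "f m t \<le> t" using f_le[of m t] by (simp add: M(2))
      then show "norm (f m t ^ k) \<le> t ^ k" using f(4) by (simp add: power_mono)
    qed
  qed measurable
  then have "(\<lambda>m. \<Sum>c\<in>f m ` space M. w m c * c ^ k) \<longlonglongrightarrow> x k" for k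
    by (simp add: moments M(5))
  then show ?thesis
    using f(2,4)
    by (intro exI[of _ "\<lambda>m. f m ` space M"] exI[of _ w]) (auto simp: simple_function_def w_def)
qed

text \<open>
  For finitely atomic measures the convolution is, by bilinearity, a nonnegative combination of
  the sequences in the second assumption; the general case is a pointwise limit.
\<close>

theorem preserves_stieltjes_moment_if_geometric:
  assumes conv: "\<And>x y n. conv x y n = (\<Sum>k\<le>n. c n k * x k * y (n - k))"
    and geometric: "\<And>s t. 0 \<le> s \<Longrightarrow> 0 \<le> t \<Longrightarrow> stieltjes_moment (\<lambda>n. \<Sum>k\<le>n. c n k * s ^ k * t ^ (n - k))"
  shows "preserves_stieltjes_moment conv"
  unfolding preserves_stieltjes_moment_def
proof (intro allI impI)
  fix x y assume "stieltjes_moment x" "stieltjes_moment y"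
  obtain C w where C: "\<And>m. finite (C m)" "\<And>m c. c \<in> C m \<Longrightarrow> 0 \<le> (c::real)" "\<And>m c. 0 \<le> w m c"
    "\<And>k. (\<lambda>m. \<Sum>c\<in>C m. w m c * c ^ k) \<longlonglongrightarrow> x k"
    using stieltjes_moment_discrete_approximation[OF \<open>stieltjes_moment x\<close>] by blast
  obtain D v where D: "\<And>m. finite (D m)" "\<And>m d. d \<in> D m \<Longrightarrow> 0 \<le> (d::real)" "\<And>m d. 0 \<le> v m d"
    "\<And>k. (\<lambda>m. \<Sum>d\<in>D m. v m d * d ^ k) \<longlonglongrightarrow> y k"
    using stieltjes_moment_discrete_approximation[OF \<open>stieltjes_moment y\<close>] by blast
  let ?x = "\<lambda>m k. \<Sum>c\<in>C m. w m c * c ^ k" and ?y = "\<lambda>m k. \<Sum>d\<in>D m. v m d * d ^ k"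
  show "stieltjes_moment (conv x y)"
  proof (rule stieltjes_moment_limit)
    show "(\<lambda>m. conv (?x m) (?y m) n) \<longlonglongrightarrow> conv x y n" for n
      unfolding conv by (intro tendsto_intros C D)
    show "stieltjes_moment (conv (?x m) (?y m))" for m
    proof -
      have eq: "conv (?x m) (?y m) n =
          (\<Sum>s\<in>C m. \<Sum>t\<in>D m. w m s * (v m t * (\<Sum>k\<le>n. c n k * s ^ k * t ^ (n - k))))" for n
      proof -
        have "conv (?x m) (?y m) n =
            (\<Sum>k\<le>n. \<Sum>s\<in>C m. \<Sum>t\<in>D m. w m s * (v m t * (c n k * s ^ k * t ^ (n - k))))"
          unfolding conv
        proof (rule sum.cong[OF refl])
          fix k
          have "c n k * ?x m k * ?y m (n - k) =
              c n k * (\<Sum>s\<in>C m. \<Sum>t\<in>D m. w m s * s ^ k * (v m t * t ^ (n - k)))"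
            by (simp only: mult.assoc[of "c n k"] sum_product)
          also have "\<dots> = (\<Sum>s\<in>C m. \<Sum>t\<in>D m. w m s * (v m t * (c n k * s ^ k * t ^ (n - k))))"
            by (simp only: sum_distrib_left mult_ac)
          finally show "c n k * ?x m k * ?y m (n - k) =
              (\<Sum>s\<in>C m. \<Sum>t\<in>D m. w m s * (v m t * (c n k * s ^ k * t ^ (n - k))))" .
        qed
        also have "\<dots> = (\<Sum>s\<in>C m. \<Sum>k\<le>n. \<Sum>t\<in>D m. w m s * (v m t * (c n k * s ^ k * t ^ (n - k))))"
          by (rule sum.swap)
        also have "\<dots> = (\<Sum>s\<in>C m. \<Sum>t\<in>D m. \<Sum>k\<le>n. w m s * (v m t * (c n k * s ^ k * t ^ (n - k))))"
          by (rule sum.cong[OF refl], rule sum.swap)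
        finally show ?thesis by (simp only: sum_distrib_left)
      qed
      show ?thesis
        unfolding ext[OF eq] using C D
        by (intro stieltjes_moment_sum stieltjes_moment_scale geometric) blast+
    qed
  qed
qed

lemma preserves_stieltjes_moment_conv_A: "preserves_stieltjes_moment conv_A"
proof (rule preserves_stieltjes_moment_if_geometric)
  let ?c = "\<lambda>n k. real (n choose k) * real (n + 1) ^ (n - k)"
  show "conv_A x y n = (\<Sum>k\<le>n. ?c n k * x k * y (n - k))" for x y n
    by (simp add: conv_A_def atLeast0AtMost)
  show "stieltjes_moment (\<lambda>n. \<Sum>k\<le>n. ?c n k * s ^ k * t ^ (n - k))" if "0 \<le> s" "0 \<le> t" for s t
  proof -
    have "(\<Sum>k\<le>n. ?c n k * s ^ k * t ^ (n - k)) = (s + real (n + 1) * t) ^ n" for n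
      unfolding binomial_ring by (rule sum.cong) (simp_all only: power_mult_distrib mult_ac)
    then show ?thesis using stieltjes_moment_Abel_Suc[OF that] by simp
  qed
qed

lemma preserves_stieltjes_moment_conv_I: "preserves_stieltjes_moment conv_I"
proof (rule preserves_stieltjes_moment_if_geometric)
  let ?c = "\<lambda>n k. if n = 0 then 1 else if k = 0 then 0 else real ((n - 1) choose (k - 1)) * real n ^ (n - k)"
  have sum_Suc: "(\<Sum>k\<le>Suc m. if k = 0 then 0 else h k) = (\<Sum>k = 1..Suc m. h k)" for m and h :: "nat \<Rightarrow> real"
    by (rule sum.mono_neutral_cong_right) auto
  show "conv_I x y n = (\<Sum>k\<le>n. ?c n k * x k * y (n - k))" for x y n
  proof (cases n)
    case (Suc m)
    have "(\<Sum>k\<le>n. ?c n k * x k * y (n - k)) =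
        (\<Sum>k\<le>Suc m. if k = 0 then 0 else
          real ((n - 1) choose (k - 1)) * real n ^ (n - k) * x k * y (n - k))"
      unfolding Suc by (rule sum.cong) auto
    also have "\<dots> = conv_I x y n"
      unfolding sum_Suc by (simp add: conv_I_def Suc del: of_nat_Suc)
    finally show ?thesis by (rule sym)
  qed (simp add: conv_I_def)
  show "stieltjes_moment (\<lambda>n. \<Sum>k\<le>n. ?c n k * s ^ k * t ^ (n - k))" if "0 \<le> s" "0 \<le> t" for s t
  proof -
    have "(\<Sum>k\<le>n. ?c n k * s ^ k * t ^ (n - k)) = (if n = 0 then 1 else s * (s + real n * t) ^ (n - 1))" for n
    proof (cases n)
      case (Suc m)
      have "(\<Sum>k\<le>n. ?c n k * s ^ k * t ^ (n - k)) =
          (\<Sum>k\<le>Suc m. if k = 0 then 0 else real (m choose (k - 1)) * real n ^ (n - k) * s ^ k * t ^ (n - k))"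
        unfolding Suc by (rule sum.cong) auto
      also have "\<dots> = (\<Sum>k = 1..Suc m. real (m choose (k - 1)) * real n ^ (n - k) * s ^ k * t ^ (n - k))"
        by (rule sum_Suc)
      also have "\<dots> = (\<Sum>k\<le>m. s * (real (m choose k) * s ^ k * (real n * t) ^ (m - k)))"
        by (rule sum.reindex_bij_witness[where i = Suc and j = "\<lambda>k. k - 1"])
          (auto simp: Suc power_mult_distrib mult_ac Suc_le_eq gr0_conv_Suc simp del: of_nat_Suc)
      also have "\<dots> = s * (s + real n * t) ^ m"
        by (simp only: binomial_ring sum_distrib_left)
      finally show ?thesis by (simp add: Suc del: of_nat_Suc)
    qed simp
    then show ?thesis using stieltjes_moment_Abel[OF that] by simp
  qed
qed

lemma stieltjes_moment_tree: "stieltjes_moment (\<lambda>i. real (Suc i) ^ i)"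
  using stieltjes_moment_Abel_Suc[of 0 1] by simp

theorem proposition4p15:
  shows
    "(totally_positive (\<lambda>n k. real (n choose k) * real k ^ (n - k)) \<and>
      totally_positive (\<lambda>i j. let n = Suc i; k = Suc j in
        real ((n - 1) choose (k - 1)) * real n ^ (n - k))) \<and>
     (totally_positive (\<lambda>n k. real (n choose k) * real k ^ (n - k) * fact k) \<and>
      totally_positive (\<lambda>i j. let n = Suc i; k = Suc j in
        real ((n - 1) choose (k - 1)) * real n ^ (n - k) * fact k)) \<and>
     (q_stieltjes_moment poly_I \<and> q_log_convex 3 poly_I) \<and>
     (q_stieltjes_moment (\<lambda>i. let n = Suc i in [:1, real n:] ^ (n - 1)) \<and>
      q_log_convex 3 (\<lambda>i. let n = Suc i in [:1, real n:] ^ (n - 1))) \<and>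
     stieltjes_moment (\<lambda>i. let n = Suc i in real n ^ (n - 1)) \<and>
     (preserves_stieltjes_moment conv_I \<and> preserves_stieltjes_moment conv_A)"
  unfolding Let_def diff_Suc_1 diff_Suc_Suc
  by (intro conjI totally_positive_idempotent totally_positive_tree
      totally_positive_idempotent_factorial totally_positive_tree_factorial
      q_stieltjes_moment_poly_I q_stieltjes_moment_forests q_log_convex_if_q_stieltjes_moment
      stieltjes_moment_tree preserves_stieltjes_moment_conv_I preserves_stieltjes_moment_conv_A)

end
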